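(* Let $\gamma,\tau>0$ and consider the Stochastic PD3O algorithm: given $p^0\in\mathcal{X}$, $y^0\in\mathcal{Y}$, for $k=0,1,2,\dots$ $$\begin{aligned} x^k&=\mathrm{prox}_{\gamma R}(p^k),\\ w^k&=2x^k-p^k-\gamma g^{k+1},\\ y^{k+1}&=\mathrm{prox}_{\tau H^*}\big(y^k+\tau L(w^k-\gamma L^*y^k)\big),\\ p^{k+1}&=x^k-\gamma g^{k+1}-\gamma L^*y^{k+1},\end{aligned}$$ where $(g^k)$ satisfies the Stochastic Gradient Assumption (see context) with constants $\alpha,\beta,\delta\ge0$, $\rho\in(0,1]$ and process $(\sigma_k)$. Suppose that $H$ is $1/\mu_{H^*}$-smooth for some $\mu_{H^*}>0$, $F$ is $\mu_F$-strongly convex for some $\mu_F\ge0$, and $R$ is $\mu_R$-strongly convex for some $\mu_R\ge0$, with $\mu:=\mu_F+2\mu_R>0$. Also suppose that $R$ is $\lambda$-smooth for some $\lambda>0$. Suppose that $\gamma\le\frac{1}{\alpha+\kappa\delta}$ for some $\kappa>\beta/\rho$, and that $\gamma\tau\|L\|^2<1$. Define, for every $k\in\mathbb{N}$, $$V^k:=\|p^k-p^\star\|^2+(1+2\tau\mu_{H^*})\|y^k-y^\star\|_{\gamma,\tau}^2+\kappa\gamma^2\sigma_k^2,$$ $$r:=\max\Big(1-\frac{\gamma\mu}{(1+\gamma\lambda)^2},\ 1-\rho+\frac{\beta}{\kappa},\ \frac{1}{1+2\tau\mu_{H^*}}\Big).$$ Then, for every $k\in\mathbb{N}$, $\mathbb{E}V^k\le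 r^kV^0$.
   Context: $\mathcal{X},\mathcal{Y}$ are finite-dimensional real Hilbert spaces, $L:\mathcal{X}\to\mathcal{Y}$ is a linear operator with adjoint $L^*$ and operator norm $\|L\|$. $F:\mathcal{X}\to\mathbb{R}$ is convex and $\nu$-smooth for some $\nu>0$. A function is $c$-smooth if it is (real-valued and) differentiable everywhere with $c$-Lipschitz gradient; $0$-strongly convex means convex. $R:\mathcal{X}\to\mathbb{R}\cup\{+\infty\}$ and $H:\mathcal{Y}\to\mathbb{R}\cup\{+\infty\}$ are proper, convex, lower semicontinuous. $G^*$ is the convex conjugate and $\mathrm{prox}_G(z)=\arg\min_{z'}\{G(z')+\tfrac12\|z-z'\|^2\}$. Standing assumption: there exists $(x^\star,y^\star)\in\mathcal{X}\times\mathcal{Y}$ with $0\in\nabla F(x^\star)+\partial R(x^\star)+L^*y^\star$ and $Lx^\star\in\partial H^*(y^\star)$; such a pair is fixed, and $p^\star=x^\star-\gamma\nabla F(x^\star)-\gamma L^*y^\star$ (so that $(p^\star,y^\star)$ is the fixed point of the iteration associated with $(x^\star,y^\star)$). $\|\cdot\|_{\gamma,\tau}$ is the norm on $\mathcal{Y}$ given by $\|y\|_{\gamma,\tau}^2=\frac{\gamma}{\tau}\|y\|^2-\gamma^2\|L^*y\|^2$. Bregman divergence: $D_F(x,x')=F(x)-F(x')-\langle\nabla F(x'),x-x'\rangle$. Stochastic Gradient Assumption: on a filtered probability space $(\Omega,\mathscr{F},(\mathscr{F}_k)_{k\in\mathbb{N}},\mathbb{P})$, with $\mathbb{E}_k$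 the conditional expectation given $\mathscr{F}_k$, $(g^k)$ is an $(\mathscr{F}_k)$-adapted $\mathcal{X}$-valued process and there exist $\alpha,\beta,\delta\ge0$, $\rho\in(0,1]$ and a real $(\mathscr{F}_k)$-adapted process $(\sigma_k)_{k\in\mathbb{N}}$ such that for every $k\in\mathbb{N}$: $\mathbb{E}_k(g^{k+1})=\nabla F(x^k)$; $\mathbb{E}_k\|g^{k+1}-\nabla F(x^\star)\|^2\le2\alpha D_F(x^k,x^\star)+\beta\sigma_k^2$; $\mathbb{E}_k(\sigma_{k+1}^2)\le(1-\rho)\sigma_k^2+2\delta D_F(x^k,x^\star)$, where $x^k$ are the iterates of the algorithm. The initial data $p^0,y^0,\sigma_0$ are deterministic. *)

theory Defs
  imports "HOL-Analysis.Analysis" "HOL-Probability.Probability"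
begin

definition grad :: "('a::euclidean_space \<Rightarrow> real) \<Rightarrow> 'a \<Rightarrow> 'a" where
  "grad f x = (THE d. GDERIV f x :> d)"

definition smooth_fun :: "real \<Rightarrow> ('a::euclidean_space \<Rightarrow> real) \<Rightarrow> bool" where
  "smooth_fun c f \<longleftrightarrow> (\<forall>x. f differentiable (at x)) \<and> c-lipschitz_on UNIV (grad f)"

definition ext_smooth :: "real \<Rightarrow> ('a::euclidean_space \<Rightarrow> ereal) \<Rightarrow> bool" where
  "ext_smooth c G \<longleftrightarrow> (\<exists>f. G = (\<lambda>x. ereal (f x)) \<and> smooth_fun c f)"

definition bregman :: "('a::euclidean_space \<Rightarrow> real) \<Rightarrow> 'a \<Rightarrow> 'a \<Rightarrow> real" where
  "bregman f x x' = f x - f x' - grad f x' \<bullet> (x - x')"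

definition proper_fun :: "('a \<Rightarrow> ereal) \<Rightarrow> bool" where
  "proper_fun G \<longleftrightarrow> (\<forall>x. G x \<noteq> - \<infinity>) \<and> (\<exists>x. G x \<noteq> \<infinity>)"

text \<open>Only used for functions that never take the value minus infinity, so the right-hand side
  below is never an indeterminate sum; \<open>ereal 0 * \<infinity> = 0\<close> makes the cases \<open>u = 0\<close> and \<open>v = 0\<close>
  harmless.\<close>

definition ext_convex :: "('a::euclidean_space \<Rightarrow> ereal) \<Rightarrow> bool" where
  "ext_convex G \<longleftrightarrow>
    (\<forall>x y. \<forall>u\<ge>0. \<forall>v\<ge>0. u + v = 1 \<longrightarrow>
       G (u *\<^sub>R x + v *\<^sub>R y) \<le> ereal u * G x + ereal v * G y)"

definition strongly_convex :: "real \<Rightarrow> ('a::euclidean_space \<Rightarrow> ereal) \<Rightarrow> bool" where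
  "strongly_convex m G \<longleftrightarrow> ext_convex (\<lambda>x. G x - ereal (m / 2 * (norm x)\<^sup>2))"

definition lower_semicont :: "('a::euclidean_space \<Rightarrow> ereal) \<Rightarrow> bool" where
  "lower_semicont G \<longleftrightarrow> (\<forall>x. G x \<le> Liminf (at x) G)"

definition subdiff :: "('a::euclidean_space \<Rightarrow> ereal) \<Rightarrow> 'a \<Rightarrow> 'a set" where
  "subdiff G x = {u. \<forall>z. G x + ereal (u \<bullet> (z - x)) \<le> G z}"

definition conjugate :: "('a::euclidean_space \<Rightarrow> ereal) \<Rightarrow> 'a \<Rightarrow> ereal" where
  "conjugate G u = (SUP x. ereal (u \<bullet> x) - G x)"

definition prox :: "('a::euclidean_space \<Rightarrow> ereal) \<Rightarrow> 'a \<Rightarrow> 'a" where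
  "prox G z = (ARG_MIN (\<lambda>z'. G z' + ereal (1 / 2 * (norm (z - z'))\<^sup>2)) z'. True)"

text \<open>The library's conditional expectation is real-valued; vectors are treated coordinatewise.\<close>

definition vec_cond_exp ::
  "'w measure \<Rightarrow> 'w measure \<Rightarrow> ('w \<Rightarrow> 'a::euclidean_space) \<Rightarrow> 'w \<Rightarrow> 'a" where
  "vec_cond_exp M N f \<omega> = (\<Sum>b\<in>Basis. real_cond_exp M N (\<lambda>\<omega>'. f \<omega>' \<bullet> b) \<omega> *\<^sub>R b)"

text \<open>Conditional expectations of squares are taken in the extended nonnegative reals, so that the
  two inequalities carry no separate integrability requirement: they assert finiteness. The first
  of them makes the conditional second moment of \<open>g (Suc k)\<close> finite almost everywhere, hence the
  coordinatewise conditional expectation in the unbiasedness condition is a genuine one, without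
  assuming \<open>g (Suc k)\<close> integrable. \<open>g 0\<close> plays no role and is left unconstrained.\<close>

definition stochastic_gradient ::
  "'w measure \<Rightarrow> (nat \<Rightarrow> 'w measure) \<Rightarrow> ('a::euclidean_space \<Rightarrow> real) \<Rightarrow> 'a \<Rightarrow>
   (nat \<Rightarrow> 'w \<Rightarrow> 'a) \<Rightarrow> (nat \<Rightarrow> 'w \<Rightarrow> 'a) \<Rightarrow> (nat \<Rightarrow> 'w \<Rightarrow> real) \<Rightarrow>
   real \<Rightarrow> real \<Rightarrow> real \<Rightarrow> real \<Rightarrow> bool" where
  "stochastic_gradient M Fil F xs x g \<sigma> \<alpha> \<beta> \<delta> \<rho> \<longleftrightarrow>
    0 \<le> \<alpha> \<and> 0 \<le> \<beta> \<and> 0 \<le> \<delta> \<and> 0 < \<rho> \<and> \<rho> \<le> 1 \<and>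
    (\<forall>k. g (Suc k) \<in> borel_measurable (Fil (Suc k))) \<and>
    (\<forall>k. \<sigma> k \<in> borel_measurable (Fil k)) \<and>
    (\<forall>k. AE \<omega> in M. vec_cond_exp M (Fil k) (g (Suc k)) \<omega> = grad F (x k \<omega>)) \<and>
    (\<forall>k. AE \<omega> in M.
       nn_cond_exp M (Fil k) (\<lambda>\<omega>'. ennreal ((norm (g (Suc k) \<omega>' - grad F xs))\<^sup>2)) \<omega>
         \<le> ennreal (2 * \<alpha> * bregman F (x k \<omega>) xs + \<beta> * (\<sigma> k \<omega>)\<^sup>2)) \<and>
    (\<forall>k. AE \<omega> in M.
       nn_cond_exp M (Fil k) (\<lambda>\<omega>'. ennreal ((\<sigma> (Suc k) \<omega>')\<^sup>2)) \<omega>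
         \<le> ennreal ((1 - \<rho>) * (\<sigma> k \<omega>)\<^sup>2 + 2 * \<delta> * bregman F (x k \<omega>) xs))"

text \<open>The square of the norm; it is nonnegative when \<open>\<gamma> * \<tau> * (onorm L)\<^sup>2 \<le> 1\<close>.\<close>

definition dual_norm_sq ::
  "('a::euclidean_space \<Rightarrow> 'b::euclidean_space) \<Rightarrow> real \<Rightarrow> real \<Rightarrow> 'b \<Rightarrow> real" where
  "dual_norm_sq L \<gamma> \<tau> y = \<gamma> / \<tau> * (norm y)\<^sup>2 - \<gamma>\<^sup>2 * (norm (adjoint L y))\<^sup>2"

end

theory Submission
  imports Defs
begin

text \<open>Since \<open>H\<close> is smooth, \<open>y (k + 1)\<close> is a gradient of \<open>H\<close> at some point, so strong monotonicity of
  the subdifferential of \<open>conjugate H\<close> is cocoercivity of the gradient of \<open>H\<close>. Writing \<open>X\<close>, \<open>Q\<close>, \<open>G\<close>,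
  \<open>E\<close> for the deviations from the solution of \<open>x\<close>, \<open>grad R x\<close>, \<open>g\<close> and \<open>grad F x\<close>, one step gives
  pathwise \<open>\<parallel>p' - ps\<parallel>\<^sup>2 + (1 + 2\<tau>\<mu>H) \<parallel>y' - ys\<parallel>\<^sup>2 \<le> \<parallel>X - \<gamma>G\<parallel>\<^sup>2 + \<gamma>\<^sup>2\<parallel>Q\<parallel>\<^sup>2 + \<parallel>y - ys\<parallel>\<^sup>2\<close>, with the dual
  norms \<open>\<parallel>\<cdot>\<parallel>\<^bsub>\<gamma>,\<tau>\<^esub>\<close>. In expectation \<open>G\<close> becomes \<open>E\<close> in the cross term, \<open>X \<bullet> E\<close> dominates the Bregman
  divergence plus \<open>\<mu>F/2 \<parallel>X\<parallel>\<^sup>2\<close>, and \<open>p - ps = X + \<gamma>Q\<close> yields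
  \<open>\<parallel>X\<parallel>\<^sup>2 + \<gamma>\<^sup>2\<parallel>Q\<parallel>\<^sup>2 \<le> \<parallel>p - ps\<parallel>\<^sup>2 - 2\<gamma>\<mu>R \<parallel>X\<parallel>\<^sup>2\<close> and \<open>\<parallel>p - ps\<parallel> \<le> (1 + \<gamma> lam) \<parallel>X\<parallel>\<close>.\<close>

section \<open>Gradients of convex functions\<close>

text \<open>\<open>grad\<close> is a definite description, so existence and uniqueness are both
  required. The derivative \<open>f'\<close> is a linear functional whose Riesz representative is
  \<open>adjoint f' 1\<close>, and derivatives are unique.\<close>

lemma GDERIV_grad:
  assumes "f differentiable (at x)"
  shows "GDERIV f x :> grad f x"
proof -
  obtain f' where f': "(f has_derivative f') (at x)"
    using assms unfolding differentiable_def by blast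
  then have "linear f'" by (rule has_derivative_linear)
  then have "f' = (\<lambda>h. h \<bullet> adjoint f' 1)"
    by (simp add: adjoint_works fun_eq_iff)
  then have ex: "GDERIV f x :> adjoint f' 1"
    using f' by (metis gderiv_def)
  have "d = adjoint f' 1" if "GDERIV f x :> d" for d
  proof -
    have "(\<lambda>h. h \<bullet> d) = (\<lambda>h. h \<bullet> adjoint f' 1)"
      using that ex unfolding gderiv_def by (rule has_derivative_unique)
    then show ?thesis by (intro iffD1[OF vector_eq_ldot]) (auto dest: fun_cong)
  qed
  with ex show ?thesis unfolding grad_def by (rule theI)
qed

lemma smooth_funD:
  assumes "smooth_fun c f"
  shows "GDERIV f x :> grad f x" "norm (grad f x - grad f z) \<le> c * norm (x - z)"
    and "continuous_on UNIV (grad f)" "continuous_on UNIV f"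
proof -
  have L: "c-lipschitz_on UNIV (grad f)" and d: "\<And>x. f differentiable (at x)"
    using assms unfolding smooth_fun_def by auto
  show "GDERIV f x :> grad f x" by (rule GDERIV_grad[OF d])
  show "norm (grad f x - grad f z) \<le> c * norm (x - z)"
    using lipschitz_onD[OF L, of x z] by (simp add: dist_norm)
  show "continuous_on UNIV (grad f)" by (rule lipschitz_on_continuous_on[OF L])
  show "continuous_on UNIV f"
    using d by (simp add: continuous_on_eq_continuous_at differentiable_imp_continuous_within)
qed

lemma GDERIV_min_eq_0:
  fixes f :: "'a::real_inner \<Rightarrow> real"
  assumes "GDERIV f x :> d" "\<And>z. f x \<le> f z"
  shows "d = 0"
proof -
  have "(\<lambda>h. h \<bullet> d) = (\<lambda>h. 0)"
    by (rule differential_zero_maxmin[of x UNIV f]) (use assms in \<open>auto simp: gderiv_def\<close>)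
  then have "d \<bullet> d = 0" by (rule fun_cong)
  then show ?thesis by simp
qed

lemma GDERIV_along_line:
  assumes "GDERIV f (x + t *\<^sub>R h) :> d"
  shows "((\<lambda>t. f (x + t *\<^sub>R h)) has_real_derivative d \<bullet> h) (at t within S)"
proof -
  have "((\<lambda>t. f (x + t *\<^sub>R h)) has_derivative (\<lambda>s. (s *\<^sub>R h) \<bullet> d)) (at t within S)"
    by (rule has_derivative_compose[of "\<lambda>t. x + t *\<^sub>R h" "\<lambda>s. s *\<^sub>R h" _ _ f "\<lambda>h. h \<bullet> d"])
      (use assms in \<open>auto intro!: derivative_eq_intros simp: gderiv_def\<close>)
  then show ?thesis
    by (simp add: has_field_derivative_def mult.commute inner_commute mult_commute_abs)
qed

text \<open>Restriction to the line through \<open>x\<close> and \<open>z\<close> reduces this to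
  the tangent inequality for a convex function of one real variable.\<close>

lemma convex_on_tangent_le:
  assumes f: "convex_on UNIV f" and d: "GDERIV f x :> d"
  shows "f x + d \<bullet> (z - x) \<le> f z"
proof -
  let ?\<phi> = "\<lambda>t. f (x + t *\<^sub>R (z - x))"
  have "convex_on UNIV ?\<phi>"
  proof (rule convex_onI)
    fix t a b :: real assume "0 < t" "t < 1"
    then have "f ((1 - t) *\<^sub>R (x + a *\<^sub>R (z - x)) + t *\<^sub>R (x + b *\<^sub>R (z - x)))
        \<le> (1 - t) * ?\<phi> a + t * ?\<phi> b"
      by (intro convex_onD[OF f]) auto
    then show "?\<phi> ((1 - t) *\<^sub>R a + t *\<^sub>R b) \<le> (1 - t) * ?\<phi> a + t * ?\<phi> b"
      by (simp add: algebra_simps)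
  qed simp
  moreover have "(?\<phi> has_real_derivative d \<bullet> (z - x)) (at 0 within UNIV)"
    by (rule GDERIV_along_line) (use d in simp)
  ultimately have "(d \<bullet> (z - x)) * (1 - 0) \<le> ?\<phi> 1 - ?\<phi> 0"
    by (intro convex_on_imp_above_tangent[where A = UNIV]) auto
  then show ?thesis by simp
qed

text \<open>Along the segment, subtracting the tangent and the quadratic term leaves
  \<open>?\<phi>\<close>, whose derivative is nonpositive by Cauchy-Schwarz and the Lipschitz bound;
  the claim compares its values at 1 and 0.\<close>

lemma gradient_lipschitz_upper_bound:
  assumes d: "\<And>x. GDERIV f x :> f' x" and lip: "\<And>x z. norm (f' x - f' z) \<le> c * norm (x - z)"
  shows "f z \<le> f x + f' x \<bullet> (z - x) + c / 2 * (norm (z - x))\<^sup>2"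
proof -
  let ?h = "z - x"
  let ?\<phi> = "\<lambda>t. f (x + t *\<^sub>R ?h) - t * (f' x \<bullet> ?h) - c / 2 * t\<^sup>2 * (norm ?h)\<^sup>2"
  have "?\<phi> 1 \<le> ?\<phi> 0"
  proof (rule DERIV_nonpos_imp_nonincreasing[where f = ?\<phi>])
    fix t :: real assume t: "0 \<le> t" "t \<le> 1"
    have "(?\<phi> has_real_derivative f' (x + t *\<^sub>R ?h) \<bullet> ?h - f' x \<bullet> ?h - c * t * (norm ?h)\<^sup>2) (at t)"
      by (rule derivative_eq_intros GDERIV_along_line[OF d] refl)+ simp
    moreover have "(f' (x + t *\<^sub>R ?h) - f' x) \<bullet> ?h \<le> c * t * (norm ?h)\<^sup>2"
    proof -
      have "(f' (x + t *\<^sub>R ?h) - f' x) \<bullet> ?h \<le> norm (f' (x + t *\<^sub>R ?h) - f' x) * norm ?h"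
        by (rule norm_cauchy_schwarz)
      also have "\<dots> \<le> c * norm (x + t *\<^sub>R ?h - x) * norm ?h"
        by (intro mult_right_mono lip) simp
      finally show ?thesis using t by (simp add: power2_eq_square mult_ac)
    qed
    ultimately show "\<exists>y. (?\<phi> has_real_derivative y) (at t) \<and> y \<le> 0"
      by (intro exI[of _ "f' (x + t *\<^sub>R ?h) \<bullet> ?h - f' x \<bullet> ?h - c * t * (norm ?h)\<^sup>2"])
        (simp add: inner_diff_left)
  qed simp
  then show ?thesis by simp
qed

text \<open>Baillon-Haddad theorem: the strengthened tangent inequality \<open>gap\<close>, added to
  itself with \<open>x\<close> and \<open>z\<close> exchanged, cancels the function values.\<close>

lemma gradient_cocoercive:
  assumes f: "convex_on UNIV f" and d: "\<And>x. GDERIV f x :> f' x"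
    and c: "c > 0" and lip: "\<And>x z. norm (f' x - f' z) \<le> c * norm (x - z)"
  shows "(norm (f' x - f' z))\<^sup>2 \<le> c * ((f' x - f' z) \<bullet> (x - z))"
proof -
  \<comment> \<open>Compare the tangent at one point with the quadratic upper bound at the other,
    after one gradient step on the tilted function \<open>f - f' x\<close>.\<close>
  have gap: "f x + f' x \<bullet> (z - x) + (norm (f' z - f' x))\<^sup>2 / (2 * c) \<le> f z" for x z
  proof -
    define e where "e = f' z - f' x"
    define u where "u = z - (1 / c) *\<^sub>R e"
    have "f x + f' x \<bullet> (u - x) \<le> f u" by (rule convex_on_tangent_le[OF f d])
    also have "f u \<le> f z + f' z \<bullet> (u - z) + c / 2 * (norm (u - z))\<^sup>2"
      by (rule gradient_lipschitz_upper_bound[OF d lip])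
    finally have "f x + f' x \<bullet> (u - x) \<le> f z + f' z \<bullet> (u - z) + c / 2 * (norm (u - z))\<^sup>2" .
    moreover have "f' x \<bullet> (u - x) - f' z \<bullet> (u - z) = f' x \<bullet> (z - x) + (e \<bullet> e) / c"
      unfolding u_def e_def by (simp add: inner_diff diff_divide_distrib)
    moreover have "c / 2 * (norm (u - z))\<^sup>2 = (norm e)\<^sup>2 / (2 * c)"
      using c unfolding u_def by (simp add: power_mult_distrib power_divide) (simp add: field_simps power2_eq_square)
    moreover have "(e \<bullet> e) / c = (norm e)\<^sup>2 / (2 * c) + (norm e)\<^sup>2 / (2 * c)"
      using c by (simp add: power2_norm_eq_inner)
    ultimately show ?thesis unfolding e_def by linarith
  qed
  have "f' x \<bullet> (z - x) + f' z \<bullet> (x - z) + (norm (f' x - f' z))\<^sup>2 / c \<le> 0"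
    using gap[of x z] gap[of z x] c by (simp add: norm_minus_commute field_simps)
  then have "(norm (f' x - f' z))\<^sup>2 / c \<le> (f' x - f' z) \<bullet> (x - z)"
    by (simp add: inner_diff)
  then show ?thesis using c by (simp add: field_simps)
qed

lemma gradient_monotone:
  assumes f: "convex_on UNIV f" and d: "\<And>x. GDERIV f x :> f' x"
  shows "0 \<le> (f' x - f' z) \<bullet> (x - z)"
  using convex_on_tangent_le[OF f d, of x z] convex_on_tangent_le[OF f d, of z x]
  by (simp add: inner_diff)

lemma ext_convex_ereal_iff: "ext_convex (\<lambda>x. ereal (f x)) \<longleftrightarrow> convex_on UNIV f"
  unfolding ext_convex_def convex_on_def by simp

text \<open>Subtracting \<open>m / 2 * (x \<bullet> x)\<close> leaves a convex function. Its tangent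
  inequality suffices, because the quadratic exceeds its own tangent by exactly the extra
  term.\<close>

lemma strongly_convex_tangent_le:
  assumes f: "strongly_convex m (\<lambda>x. ereal (f x))" and d: "GDERIV f x :> d"
  shows "f x + d \<bullet> (z - x) + m / 2 * (norm (z - x))\<^sup>2 \<le> f z"
proof -
  let ?h = "\<lambda>x. f x - m / 2 * (x \<bullet> x)"
  have "convex_on UNIV ?h"
    using f unfolding strongly_convex_def by (simp add: ext_convex_ereal_iff power2_norm_eq_inner)
  moreover have "GDERIV ?h x :> d - m *\<^sub>R x"
  proof -
    have "((\<lambda>x. m / 2 * (x \<bullet> x)) has_derivative (\<lambda>h. h \<bullet> (m *\<^sub>R x))) (at x)"
      by (auto intro!: derivative_eq_intros simp: inner_commute)
    with d show ?thesis by (intro GDERIV_diff) (auto simp: gderiv_def)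
  qed
  ultimately have "?h x + (d - m *\<^sub>R x) \<bullet> (z - x) \<le> ?h z" by (rule convex_on_tangent_le)
  then show ?thesis
    by (simp add: power2_norm_eq_inner algebra_simps inner_diff inner_commute)
qed

text \<open>A subgradient \<open>u\<close> makes \<open>x\<close> a minimiser of the tilted function
  \<open>f z - z \<bullet> u\<close>, whose gradient \<open>d - u\<close> must then vanish.\<close>

lemma subdiff_gradient:
  assumes "u \<in> subdiff (\<lambda>x. ereal (f x)) x" and d: "GDERIV f x :> d"
  shows "u = d"
proof -
  have "((\<lambda>z. z \<bullet> u) has_derivative (\<lambda>h. h \<bullet> u)) (at x)"
    by (auto intro!: derivative_eq_intros)
  with d have "GDERIV (\<lambda>z. f z - z \<bullet> u) x :> d - u"
    by (intro GDERIV_diff) (auto simp: gderiv_def)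
  moreover have "f x - x \<bullet> u \<le> f z - z \<bullet> u" for z
  proof -
    have "f x + u \<bullet> (z - x) \<le> f z" using assms(1) unfolding subdiff_def by simp
    then show ?thesis by (simp add: inner_diff_right inner_commute[of _ u])
  qed
  ultimately have "d - u = 0" by (rule GDERIV_min_eq_0)
  then show ?thesis by simp
qed

section \<open>Proximal operators\<close>

text \<open>Completing the square shows that the objective at \<open>u\<close> exceeds its finite
  value at \<open>x\<close> by at least half the squared distance from \<open>u\<close> to
  \<open>x\<close>. The minimiser is therefore unique, which determines the choice made by
  \<open>ARG_MIN\<close>.\<close>

lemma prox_eqI:
  assumes x: "G x = ereal a" and sub: "z - x \<in> subdiff G x"
  shows "prox G z = x"
proof -
  let ?J = "\<lambda>u. G u + ereal (1 / 2 * (norm (z - u))\<^sup>2)"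
  have J: "ereal (a + 1 / 2 * (norm (z - x))\<^sup>2 + 1 / 2 * (norm (u - x))\<^sup>2) \<le> ?J u" for u
  proof -
    have "ereal (a + (z - x) \<bullet> (u - x)) \<le> G u"
      using sub x unfolding subdiff_def by simp
    then have "ereal (a + (z - x) \<bullet> (u - x)) + ereal (1 / 2 * (norm (z - u))\<^sup>2) \<le> ?J u"
      by (rule add_right_mono)
    moreover have "(z - x) \<bullet> (u - x) + 1 / 2 * (norm (z - u))\<^sup>2
        = 1 / 2 * (norm (z - x))\<^sup>2 + 1 / 2 * (norm (u - x))\<^sup>2"
      by (simp add: power2_norm_eq_inner algebra_simps inner_diff inner_commute)
    ultimately show ?thesis by (simp add: add.assoc)
  qed
  have less: "?J x < ?J u" if "u \<noteq> x" for u
    using that x by (intro less_le_trans[OF _ J]) simp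
  have "is_arg_min ?J (\<lambda>_. True) = (\<lambda>u. u = x)"
    unfolding is_arg_min_def fun_eq_iff using less by (metis less_asym)
  then show ?thesis unfolding prox_def arg_min_def by (simp only: some_eq_trivial)
qed

text \<open>The equation is the stationarity condition of \<open>c f\<close> plus half the squared
  distance to \<open>z\<close>. A minimiser exists by compactness of a ball around
  \<open>z\<close>.\<close>

lemma ex_prox_gradient:
  fixes f :: "'a::euclidean_space \<Rightarrow> real"
  assumes f: "convex_on UNIV f" and d: "\<And>x. GDERIV f x :> f' x" and cont: "continuous_on UNIV f"
    and c: "c \<ge> 0"
  shows "\<exists>x. z = x + c *\<^sub>R f' x"
proof -
  let ?J = "\<lambda>u. c * f u + 1 / 2 * ((u - z) \<bullet> (u - z))"
  \<comment> \<open>The radius is chosen so that outside the ball half the squared distance to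
    \<open>z\<close> outweighs the decrease of \<open>c f\<close> permitted by its tangent at
    \<open>z\<close>; hence the minimum over the ball is global.\<close>
  define \<rho> where "\<rho> = 2 * c * norm (f' z)"
  have "compact (cball z \<rho>)" "cball z \<rho> \<noteq> {}" using c by (simp_all add: \<rho>_def not_less)
  moreover have "continuous_on (cball z \<rho>) ?J"
    by (intro continuous_intros continuous_on_subset[OF cont]) simp
  ultimately obtain x where x: "\<And>u. u \<in> cball z \<rho> \<Longrightarrow> ?J x \<le> ?J u"
    using continuous_attains_inf by meson
  have "?J x \<le> ?J u" for u
  proof (cases "u \<in> cball z \<rho>")
    case False
    have "?J x \<le> ?J z" using c by (intro x) (simp add: \<rho>_def)
    also have "\<dots> = c * f z" by simp
    also have "\<dots> \<le> c * (f u + norm (f' z) * norm (u - z))"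
    proof (rule mult_left_mono[OF _ c])
      show "f z \<le> f u + norm (f' z) * norm (u - z)"
        using convex_on_tangent_le[OF f d, of z u] Cauchy_Schwarz_ineq2[of "f' z" "u - z"] by simp
    qed
    also have "\<dots> = c * f u + 1 / 2 * (\<rho> * norm (u - z))" by (simp add: \<rho>_def algebra_simps)
    also have "\<dots> \<le> c * f u + 1 / 2 * (norm (u - z) * norm (u - z))"
      using False by (intro add_left_mono mult_left_mono mult_right_mono)
        (auto simp: dist_norm norm_minus_commute)
    finally show ?thesis by (simp add: dot_square_norm power2_eq_square)
  qed (rule x)
  moreover have "GDERIV ?J x :> c *\<^sub>R f' x + (x - z)"
  proof (rule GDERIV_add)
    show "GDERIV (\<lambda>u. c * f u) x :> c *\<^sub>R f' x"
      using d[of x] unfolding gderiv_def by (auto intro!: derivative_eq_intros)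
    show "GDERIV (\<lambda>u. 1 / 2 * ((u - z) \<bullet> (u - z))) x :> x - z"
      unfolding gderiv_def by (auto intro!: derivative_eq_intros simp: inner_commute)
  qed
  ultimately have "c *\<^sub>R f' x + (x - z) = 0" by (rule GDERIV_min_eq_0[rotated])
  then show ?thesis by (intro exI[of _ x]) (simp add: algebra_simps)
qed

text \<open>The stationarity equation has a solution \<open>v\<close>, and \<open>z - v\<close> is a
  subgradient of \<open>c f\<close> at \<open>v\<close>, so \<open>prox_eqI\<close> identifies
  \<open>v\<close> with the prox.\<close>

lemma prox_gradient:
  fixes f :: "'a::euclidean_space \<Rightarrow> real"
  assumes f: "convex_on UNIV f" and d: "\<And>x. GDERIV f x :> f' x" and cont: "continuous_on UNIV f"
    and c: "c \<ge> 0" and x: "x = prox (\<lambda>u. ereal c * ereal (f u)) z"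
  shows "z = x + c *\<^sub>R f' x"
proof -
  obtain v where v: "z = v + c *\<^sub>R f' v" using ex_prox_gradient[OF f d cont c] by blast
  have "prox (\<lambda>u. ereal c * ereal (f u)) z = v"
  proof (rule prox_eqI)
    show "ereal c * ereal (f v) = ereal (c * f v)" by simp
    show "z - v \<in> subdiff (\<lambda>u. ereal c * ereal (f u)) v"
      unfolding subdiff_def v using mult_left_mono[OF convex_on_tangent_le[OF f d] c]
      by (simp add: algebra_simps)
  qed
  with x v show ?thesis by simp
qed

text \<open>Equality case of the Fenchel-Young inequality: by the tangent inequality at
  \<open>u\<close> the supremum is attained there.\<close>

lemma conjugate_gradient:
  assumes f: "convex_on UNIV f" and d: "\<And>x. GDERIV f x :> f' x"
  shows "conjugate (\<lambda>x. ereal (f x)) (f' u) = ereal (f' u \<bullet> u - f u)"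
  unfolding conjugate_def
proof (rule antisym)
  show "(SUP x. ereal (f' u \<bullet> x) - ereal (f x)) \<le> ereal (f' u \<bullet> u - f u)"
    using convex_on_tangent_le[OF f d, of u] by (intro SUP_least) (simp add: algebra_simps)
  show "ereal (f' u \<bullet> u - f u) \<le> (SUP x. ereal (f' u \<bullet> x) - ereal (f x))"
    by (rule SUP_upper2[of u]) auto
qed

lemma conjugate_ge: "ereal (v \<bullet> u - f u) \<le> conjugate (\<lambda>x. ereal (f x)) v"
  unfolding conjugate_def by (rule SUP_upper2[of u]) auto

text \<open>Testing the subgradient inequality at \<open>f' u\<close>, where the conjugate is known
  explicitly, gives equality in Fenchel-Young for \<open>u\<close> and \<open>v\<close>. So
  \<open>v\<close> is a subgradient of \<open>f\<close> at \<open>u\<close>.\<close>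

lemma subdiff_conjugate_gradient:
  assumes f: "convex_on UNIV f" and d: "\<And>x. GDERIV f x :> f' x"
    and u: "u \<in> subdiff (conjugate (\<lambda>x. ereal (f x))) v"
  shows "v = f' u"
proof -
  let ?C = "conjugate (\<lambda>x. ereal (f x))"
  have "?C v + ereal (u \<bullet> (f' u - v)) \<le> ?C (f' u)" using u unfolding subdiff_def by blast
  then have "?C v \<le> ereal (v \<bullet> u - f u)"
    unfolding conjugate_gradient[OF f d] by (cases "?C v") (auto simp: inner_diff inner_commute)
  then have "ereal (v \<bullet> w - f w) \<le> ereal (v \<bullet> u - f u)" for w
    using conjugate_ge[of v w f] by (meson order_trans)
  then have "v \<in> subdiff (\<lambda>x. ereal (f x)) u"
    unfolding subdiff_def by (auto simp: inner_diff algebra_simps)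
  then show ?thesis using d by (rule subdiff_gradient)
qed

text \<open>Moreau's identity in gradient form: \<open>prox\<close> of \<open>t f\<^sup>*\<close> at \<open>z\<close> is \<open>f' u\<close>, where
  \<open>u = prox (f / t) (z / t)\<close>.\<close>

lemma prox_conjugate_gradient:
  fixes f :: "'a::euclidean_space \<Rightarrow> real"
  assumes f: "convex_on UNIV f" and d: "\<And>x. GDERIV f x :> f' x" and cont: "continuous_on UNIV f"
    and t: "t > 0" and v: "v = prox (\<lambda>u. ereal t * conjugate (\<lambda>x. ereal (f x)) u) z"
  shows "\<exists>u. v = f' u \<and> z = v + t *\<^sub>R u"
proof -
  let ?C = "conjugate (\<lambda>x. ereal (f x))"
  obtain u where "(1 / t) *\<^sub>R z = u + (1 / t) *\<^sub>R f' u"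
    using ex_prox_gradient[OF f d cont, of "1 / t"] t by auto
  then have "t *\<^sub>R ((1 / t) *\<^sub>R z) = t *\<^sub>R (u + (1 / t) *\<^sub>R f' u)" by simp
  then have z: "z = f' u + t *\<^sub>R u" using t by (simp add: scaleR_add_right)
  have "prox (\<lambda>w. ereal t * ?C w) z = f' u"
  proof (rule prox_eqI)
    show "ereal t * ?C (f' u) = ereal (t * (f' u \<bullet> u - f u))"
      by (simp add: conjugate_gradient[OF f d])
    have "ereal (t * (f' u \<bullet> u - f u)) + ereal ((z - f' u) \<bullet> (w - f' u)) \<le> ereal t * ?C w" for w
    proof -
      have "ereal (t * (f' u \<bullet> u - f u)) + ereal ((z - f' u) \<bullet> (w - f' u))
          = ereal t * ereal (w \<bullet> u - f u)"
        unfolding z by (simp add: inner_diff inner_commute algebra_simps)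
      also have "\<dots> \<le> ereal t * ?C w"
        using t by (intro ereal_mult_left_mono conjugate_ge) auto
      finally show ?thesis .
    qed
    then show "z - f' u \<in> subdiff (\<lambda>w. ereal t * ?C w) (f' u)"
      unfolding subdiff_def by (simp add: conjugate_gradient[OF f d])
  qed
  with v z show ?thesis by auto
qed

text \<open>Expanding the square adds only nonnegative terms. With \<open>a\<close> the difference
  of two prox values and \<open>a \<bullet> b\<close> nonnegative by monotonicity, this is
  nonexpansiveness of the prox.\<close>

lemma norm_le_norm_add_monotone:
  fixes a b :: "'a::real_inner"
  assumes "0 \<le> a \<bullet> b" "0 \<le> t"
  shows "norm a \<le> norm (a + t *\<^sub>R b)"
proof -
  have "(norm (a + t *\<^sub>R b))\<^sup>2 = (norm a)\<^sup>2 + 2 * t * (a \<bullet> b) + (norm (t *\<^sub>R b))\<^sup>2"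
    unfolding power2_norm_eq_inner by (simp add: algebra_simps inner_add inner_commute)
  then have "(norm a)\<^sup>2 \<le> (norm (a + t *\<^sub>R b))\<^sup>2" using assms by simp
  then show ?thesis by (rule power2_le_imp_le) simp
qed

lemma continuous_on_nonexpansive:
  fixes h :: "'a::real_normed_vector \<Rightarrow> 'b::real_normed_vector"
  assumes "\<And>x z. norm (h x - h z) \<le> norm (x - z)"
  shows "continuous_on UNIV h"
  by (rule lipschitz_on_continuous_on[of 1]) (use assms in \<open>auto intro!: lipschitz_onI simp: dist_norm\<close>)

text \<open>Continuity of the prox maps is what later makes the iterates measurable.\<close>

lemma continuous_on_prox_gradient:
  fixes f :: "'a::euclidean_space \<Rightarrow> real"
  assumes f: "convex_on UNIV f" and d: "\<And>x. GDERIV f x :> f' x" and cont: "continuous_on UNIV f"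
    and c: "c \<ge> 0"
  shows "continuous_on UNIV (prox (\<lambda>u. ereal c * ereal (f u)))"
proof (rule continuous_on_nonexpansive)
  fix z1 z2
  define x1 x2 where "x1 = prox (\<lambda>u. ereal c * ereal (f u)) z1"
    and "x2 = prox (\<lambda>u. ereal c * ereal (f u)) z2"
  have "z1 - z2 = x1 - x2 + c *\<^sub>R (f' x1 - f' x2)"
    using prox_gradient[OF f d cont c x1_def] prox_gradient[OF f d cont c x2_def]
    by (simp add: algebra_simps)
  moreover have "norm (x1 - x2) \<le> norm (x1 - x2 + c *\<^sub>R (f' x1 - f' x2))"
    using gradient_monotone[OF f d, of x1 x2] c
    by (intro norm_le_norm_add_monotone) (simp_all add: inner_commute)
  ultimately show "norm (x1 - x2) \<le> norm (z1 - z2)" by simp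
qed

text \<open>The prox values are now gradients at \<open>u1\<close> and \<open>u2\<close>, so in the
  monotonicity of \<open>f'\<close> the gradient difference takes the role of \<open>a\<close> and
  \<open>u1 - u2\<close> that of \<open>b\<close>.\<close>

lemma continuous_on_prox_conjugate:
  fixes f :: "'a::euclidean_space \<Rightarrow> real"
  assumes f: "convex_on UNIV f" and d: "\<And>x. GDERIV f x :> f' x" and cont: "continuous_on UNIV f"
    and t: "t > 0"
  shows "continuous_on UNIV (prox (\<lambda>u. ereal t * conjugate (\<lambda>x. ereal (f x)) u))"
proof (rule continuous_on_nonexpansive)
  fix z1 z2
  define P where "P = prox (\<lambda>u. ereal t * conjugate (\<lambda>x. ereal (f x)) u)"
  obtain u1 where u1: "P z1 = f' u1" "z1 = P z1 + t *\<^sub>R u1"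
    using prox_conjugate_gradient[OF f d cont t, of "P z1" z1] unfolding P_def by blast
  obtain u2 where u2: "P z2 = f' u2" "z2 = P z2 + t *\<^sub>R u2"
    using prox_conjugate_gradient[OF f d cont t, of "P z2" z2] unfolding P_def by blast
  have "z1 - z2 = P z1 - P z2 + t *\<^sub>R (u1 - u2)"
    by (subst u1(2), subst u2(2)) (simp add: algebra_simps)
  moreover have "norm (P z1 - P z2) \<le> norm (P z1 - P z2 + t *\<^sub>R (u1 - u2))"
    using gradient_monotone[OF f d, of u1 u2] t u1(1) u2(1)
    by (intro norm_le_norm_add_monotone) simp_all
  ultimately show "norm (P z1 - P z2) \<le> norm (z1 - z2)" by simp
qed

section \<open>One deterministic step\<close>

text \<open>The lower bound needs \<open>norm (adjoint L y) \<le> onorm L * norm y\<close>, obtained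
  by writing the squared norm as \<open>L (adjoint L y) \<bullet> y\<close> and cancelling one
  factor.\<close>

lemma dual_norm_sq_bounds:
  fixes L :: "'a::euclidean_space \<Rightarrow> 'b::euclidean_space"
  assumes L: "linear L" and pos: "\<gamma> > 0" "\<tau> > 0" and le: "\<gamma> * \<tau> * (onorm L)\<^sup>2 \<le> 1"
  shows "0 \<le> dual_norm_sq L \<gamma> \<tau> y" and "dual_norm_sq L \<gamma> \<tau> y \<le> \<gamma> / \<tau> * (norm y)\<^sup>2"
proof -
  let ?a = "adjoint L y"
  have "(norm ?a)\<^sup>2 = L ?a \<bullet> y"
    by (simp add: power2_norm_eq_inner adjoint_works[OF L, symmetric])
  also have "\<dots> \<le> onorm L * norm ?a * norm y"
    using L by (intro order_trans[OF norm_cauchy_schwarz] mult_right_mono onorm)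
      (auto simp: linear_conv_bounded_linear)
  finally have "norm ?a * norm ?a \<le> norm ?a * (onorm L * norm y)"
    by (simp add: power2_eq_square mult_ac)
  then have "norm ?a \<le> onorm L * norm y"
    using L by (cases "?a = 0") (auto simp: linear_conv_bounded_linear onorm_pos_le)
  then have "(norm ?a)\<^sup>2 \<le> (onorm L)\<^sup>2 * (norm y)\<^sup>2"
    by (metis norm_ge_zero power_mono power_mult_distrib)
  then have "\<gamma> * \<tau> * (norm ?a)\<^sup>2 \<le> (\<gamma> * \<tau> * (onorm L)\<^sup>2) * (norm y)\<^sup>2"
    using pos by simp
  also have "\<dots> \<le> 1 * (norm y)\<^sup>2" by (intro mult_right_mono le) simp
  finally have "\<gamma> / \<tau> * (\<gamma> * \<tau> * (norm ?a)\<^sup>2) \<le> \<gamma> / \<tau> * (norm y)\<^sup>2"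
    using pos by (intro mult_left_mono) auto
  then show "0 \<le> dual_norm_sq L \<gamma> \<tau> y"
    unfolding dual_norm_sq_def using pos by (simp add: power2_eq_square)
  show "dual_norm_sq L \<gamma> \<tau> y \<le> \<gamma> / \<tau> * (norm y)\<^sup>2"
    unfolding dual_norm_sq_def by simp
qed

lemma pd3o_step_descent:
  fixes L :: "'a::euclidean_space \<Rightarrow> 'b::euclidean_space"
  assumes L: "linear L" and pos: "\<gamma> > 0" "\<tau> > 0" and le: "\<gamma> * \<tau> * (onorm L)\<^sup>2 \<le> 1"
    and dual: "Y' + \<tau> *\<^sub>R U = Y + \<tau> *\<^sub>R L (X - \<gamma> *\<^sub>R Q - \<gamma> *\<^sub>R G - \<gamma> *\<^sub>R adjoint L Y)"
    and \<mu>: "0 \<le> \<mu>" "\<mu> * (norm Y')\<^sup>2 \<le> Y' \<bullet> U"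
  shows "(norm (X - \<gamma> *\<^sub>R G - \<gamma> *\<^sub>R adjoint L Y'))\<^sup>2 + (1 + 2 * \<tau> * \<mu>) * dual_norm_sq L \<gamma> \<tau> Y'
    \<le> (norm (X - \<gamma> *\<^sub>R G))\<^sup>2 + \<gamma>\<^sup>2 * (norm Q)\<^sup>2 + dual_norm_sq L \<gamma> \<tau> Y"
proof -
  define A where "A = adjoint L Y"
  define B where "B = adjoint L Y'"
  define Z where "Z = X - \<gamma> *\<^sub>R G"
  define s where "s = \<gamma> / \<tau>"
  let ?d = "dual_norm_sq L \<gamma> \<tau>"
  \<comment> \<open>Pairing the dual update with \<open>Y'\<close> and moving \<open>L\<close> to
    the other side as its adjoint expresses \<open>Y' \<bullet> U\<close> through \<open>A\<close>,
    \<open>B\<close> and \<open>Z\<close>.\<close>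
  have "(Y' + \<tau> *\<^sub>R U) \<bullet> Y' = (Y + \<tau> *\<^sub>R L (X - \<gamma> *\<^sub>R Q - \<gamma> *\<^sub>R G - \<gamma> *\<^sub>R A)) \<bullet> Y'"
    using dual by (simp add: A_def)
  then have "\<tau> * (U \<bullet> Y') = (Y - Y') \<bullet> Y' + \<tau> * ((Z - \<gamma> *\<^sub>R Q - \<gamma> *\<^sub>R A) \<bullet> B)"
    by (simp add: inner_add_left inner_diff_left B_def Z_def adjoint_works[OF L, symmetric]
        linear_diff[OF L] linear_cmul[OF L] algebra_simps)
  then have "s * (\<tau> * (U \<bullet> Y')) = s * ((Y - Y') \<bullet> Y' + \<tau> * ((Z - \<gamma> *\<^sub>R Q - \<gamma> *\<^sub>R A) \<bullet> B))"
    by simp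
  then have UY: "\<gamma> * (Y' \<bullet> U) = s * ((Y - Y') \<bullet> Y') + \<gamma> * ((Z - \<gamma> *\<^sub>R Q - \<gamma> *\<^sub>R A) \<bullet> B)"
    using pos by (simp add: s_def distrib_left inner_commute)
  have d: "?d Y = s * (Y \<bullet> Y) - \<gamma>\<^sup>2 * (A \<bullet> A)" "?d Y' = s * (Y' \<bullet> Y') - \<gamma>\<^sup>2 * (B \<bullet> B)"
    "?d (Y - Y') = s * ((Y - Y') \<bullet> (Y - Y')) - \<gamma>\<^sup>2 * ((A - B) \<bullet> (A - B))"
    unfolding dual_norm_sq_def s_def A_def B_def
    by (simp_all add: power2_norm_eq_inner linear_diff[OF adjoint_linear[OF L]])
  \<comment> \<open>An exact identity: the cross terms in \<open>Z \<bullet> B\<close> cancel, and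
    the term in \<open>Q \<bullet> B\<close> is absorbed into a completed square. The two subtracted
    squares on the right are nonnegative and are dropped below.\<close>
  have "(norm (Z - \<gamma> *\<^sub>R B))\<^sup>2 + ?d Y' + 2 * (\<gamma> * (Y' \<bullet> U))
      = (norm Z)\<^sup>2 + \<gamma>\<^sup>2 * (norm Q)\<^sup>2 - \<gamma>\<^sup>2 * (norm (Q + B))\<^sup>2 + ?d Y - ?d (Y - Y')"
    unfolding UY d power2_norm_eq_inner
    by (simp add: inner_add_left inner_add_right inner_diff_left inner_diff_right inner_commute
        power2_eq_square algebra_simps)
  moreover have "0 \<le> ?d (Y - Y')" by (rule dual_norm_sq_bounds(1)[OF L pos le])
  moreover have "\<tau> * \<mu> * ?d Y' \<le> \<gamma> * (Y' \<bullet> U)"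
  proof -
    have "\<tau> * \<mu> * ?d Y' \<le> \<tau> * \<mu> * (\<gamma> / \<tau> * (norm Y')\<^sup>2)"
      using pos \<mu> by (intro mult_left_mono dual_norm_sq_bounds(2)[OF L pos le]) auto
    also have "\<dots> = \<gamma> * (\<mu> * (norm Y')\<^sup>2)" using pos by simp
    also have "\<dots> \<le> \<gamma> * (Y' \<bullet> U)" using pos \<mu> by (intro mult_left_mono) auto
    finally show ?thesis .
  qed
  moreover have "0 \<le> \<gamma>\<^sup>2 * (norm (Q + B))\<^sup>2" by simp
  moreover have "(1 + 2 * \<tau> * \<mu>) * ?d Y' = ?d Y' + 2 * (\<tau> * \<mu> * ?d Y')"
    by (simp add: algebra_simps)
  ultimately show ?thesis unfolding B_def[symmetric] Z_def[symmetric] by linarith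
qed

text \<open>Here \<open>a = \<parallel>x - xs\<parallel>\<^sup>2\<close>, \<open>q\<close> is the squared norm of the difference \<open>Q\<close> of the gradients of \<open>R\<close>,
  \<open>b = (x - xs) \<bullet> Q\<close>, \<open>P = \<parallel>p - ps\<parallel>\<^sup>2\<close>, \<open>e\<close> pairs \<open>x - xs\<close> with the difference of the gradients
  of \<open>F\<close>, \<open>D\<close> is the Bregman divergence, \<open>d\<close> the squared dual norm and \<open>s = \<sigma>\<^sup>2\<close>.\<close>

lemma lyapunov_contraction:
  fixes a b q e D d s P r \<gamma> \<tau> lam \<alpha> \<beta> \<delta> \<rho> \<kappa> \<mu>F \<mu>R \<mu>H :: real
  assumes P: "P = a + 2 * \<gamma> * b + \<gamma>\<^sup>2 * q" "P \<le> (1 + \<gamma> * lam)\<^sup>2 * a"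
    and e: "D + \<mu>F / 2 * a \<le> e" and b: "\<mu>R * a \<le> b"
    and nonneg: "0 \<le> D" "0 \<le> d" "0 \<le> s" "0 \<le> P" "0 \<le> \<mu>F" "0 \<le> \<mu>R"
    and pos: "0 < \<gamma>" "0 < \<tau>" "0 < lam" "0 < \<kappa>" "0 < \<mu>H"
    and step: "\<gamma> * (\<alpha> + \<kappa> * \<delta>) \<le> 1"
    and r: "1 - \<gamma> * (\<mu>F + 2 * \<mu>R) / (1 + \<gamma> * lam)\<^sup>2 \<le> r" "1 - \<rho> + \<beta> / \<kappa> \<le> r"
      "1 / (1 + 2 * \<tau> * \<mu>H) \<le> r"
  shows "a - 2 * \<gamma> * e + \<gamma>\<^sup>2 * (2 * \<alpha> * D + \<beta> * s) + \<gamma>\<^sup>2 * q + d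
      + \<kappa> * \<gamma>\<^sup>2 * ((1 - \<rho>) * s + 2 * \<delta> * D)
    \<le> r * (P + (1 + 2 * \<tau> * \<mu>H) * d + \<kappa> * \<gamma>\<^sup>2 * s)"
proof -
  let ?\<mu> = "\<mu>F + 2 * \<mu>R"
  \<comment> \<open>The bound on \<open>P\<close> by \<open>a\<close> turns the decrease
    proportional to \<open>a\<close> into a contraction of \<open>P\<close>.\<close>
  have P1: "P - \<gamma> * ?\<mu> * a \<le> r * P"
  proof -
    have "0 < 1 + \<gamma> * lam" using pos by (simp add: add_pos_pos)
    then have "P / (1 + \<gamma> * lam)\<^sup>2 \<le> a" using P(2) by (simp add: divide_le_eq mult.commute)
    then have "\<gamma> * ?\<mu> * (P / (1 + \<gamma> * lam)\<^sup>2) \<le> \<gamma> * ?\<mu> * a"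
      using pos nonneg by (intro mult_left_mono) auto
    then have "P - \<gamma> * ?\<mu> * a \<le> (1 - \<gamma> * ?\<mu> / (1 + \<gamma> * lam)\<^sup>2) * P"
      by (simp add: left_diff_distrib)
    also have "\<dots> \<le> r * P" using r(1) nonneg by (intro mult_right_mono) auto
    finally show ?thesis .
  qed
  have d1: "d \<le> r * ((1 + 2 * \<tau> * \<mu>H) * d)"
  proof -
    have "0 < 1 + 2 * \<tau> * \<mu>H" using pos by (simp add: add_pos_pos)
    then have "1 \<le> r * (1 + 2 * \<tau> * \<mu>H)" using r(3) by (simp add: divide_le_eq)
    then have "1 * d \<le> r * (1 + 2 * \<tau> * \<mu>H) * d" by (rule mult_right_mono[OF _ nonneg(2)])
    then show ?thesis by (simp add: mult.assoc)
  qed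
  have s1: "\<kappa> * \<gamma>\<^sup>2 * ((1 - \<rho>) * s) + \<gamma>\<^sup>2 * (\<beta> * s) \<le> r * (\<kappa> * \<gamma>\<^sup>2 * s)"
  proof -
    have "\<kappa> * \<gamma>\<^sup>2 * ((1 - \<rho>) * s) + \<gamma>\<^sup>2 * (\<beta> * s) = (1 - \<rho> + \<beta> / \<kappa>) * (\<kappa> * \<gamma>\<^sup>2 * s)"
      using pos by (simp add: field_simps)
    also have "\<dots> \<le> r * (\<kappa> * \<gamma>\<^sup>2 * s)" using r(2) pos nonneg by (intro mult_right_mono) auto
    finally show ?thesis .
  qed
  \<comment> \<open>The step-size condition: both Bregman terms, one from the gradient variance and
    one from the update of \<sigma>, are paid for by the \<open>2 * \<gamma> * D\<close> contained
    in \<open>2 * \<gamma> * e\<close>.\<close>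
  have D1: "\<gamma>\<^sup>2 * (2 * \<alpha> * D) + \<kappa> * \<gamma>\<^sup>2 * (2 * \<delta> * D) \<le> 2 * \<gamma> * D"
  proof -
    have "2 * \<gamma> * D * (\<gamma> * (\<alpha> + \<kappa> * \<delta>)) \<le> 2 * \<gamma> * D * 1"
      using step pos nonneg by (intro mult_left_mono) auto
    then show ?thesis by (simp add: power2_eq_square algebra_simps)
  qed
  have e1: "2 * \<gamma> * D + \<gamma> * \<mu>F * a \<le> 2 * \<gamma> * e"
    using mult_left_mono[OF e, of "2 * \<gamma>"] pos by (simp add: algebra_simps)
  have b1: "2 * \<gamma> * \<mu>R * a \<le> 2 * \<gamma> * b"
    using mult_left_mono[OF b, of "2 * \<gamma>"] pos by (simp add: algebra_simps)
  have split: "\<gamma> * ?\<mu> * a = \<gamma> * \<mu>F * a + 2 * \<gamma> * \<mu>R * a"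
    "\<gamma>\<^sup>2 * (2 * \<alpha> * D + \<beta> * s) = \<gamma>\<^sup>2 * (2 * \<alpha> * D) + \<gamma>\<^sup>2 * (\<beta> * s)"
    "\<kappa> * \<gamma>\<^sup>2 * ((1 - \<rho>) * s + 2 * \<delta> * D) = \<kappa> * \<gamma>\<^sup>2 * ((1 - \<rho>) * s) + \<kappa> * \<gamma>\<^sup>2 * (2 * \<delta> * D)"
    "r * (P + (1 + 2 * \<tau> * \<mu>H) * d + \<kappa> * \<gamma>\<^sup>2 * s)
      = r * P + r * ((1 + 2 * \<tau> * \<mu>H) * d) + r * (\<kappa> * \<gamma>\<^sup>2 * s)"
    by (simp_all add: algebra_simps)
  \<comment> \<open>By \<open>P(1)\<close>, the terms \<open>a + \<gamma>\<^sup>2 * q\<close> equal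
    \<open>P - 2 * \<gamma> * b\<close>; the \<open>b\<close> term then supplies the strong
    convexity of \<open>R\<close>.\<close>
  show ?thesis
    unfolding split(2-) using P1[unfolded split(1)] d1 s1 D1 e1 b1 P(1) by linarith
qed

section \<open>Expectations\<close>

lemma integrable_inner_of_square_integrable:
  fixes X Y :: "'w \<Rightarrow> 'a::euclidean_space"
  assumes [measurable]: "X \<in> borel_measurable M" "Y \<in> borel_measurable M"
    and "integrable M (\<lambda>\<omega>. (norm (X \<omega>))\<^sup>2)" "integrable M (\<lambda>\<omega>. (norm (Y \<omega>))\<^sup>2)"
  shows "integrable M (\<lambda>\<omega>. X \<omega> \<bullet> Y \<omega>)"
proof (rule Bochner_Integration.integrable_bound)
  show "integrable M (\<lambda>\<omega>. (norm (X \<omega>))\<^sup>2 + (norm (Y \<omega>))\<^sup>2)" using assms by simp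
  have "\<bar>X \<omega> \<bullet> Y \<omega>\<bar> \<le> (norm (X \<omega>))\<^sup>2 + (norm (Y \<omega>))\<^sup>2" for \<omega>
  proof -
    have "2 * (norm (X \<omega>) * norm (Y \<omega>)) \<le> (norm (X \<omega>))\<^sup>2 + (norm (Y \<omega>))\<^sup>2"
      using sum_squares_bound[of "norm (X \<omega>)" "norm (Y \<omega>)"] by simp
    moreover have "0 \<le> norm (X \<omega>) * norm (Y \<omega>)" by simp
    ultimately show ?thesis using Cauchy_Schwarz_ineq2[of "X \<omega>" "Y \<omega>"] by linarith
  qed
  then show "AE \<omega> in M. norm (X \<omega> \<bullet> Y \<omega>) \<le> norm ((norm (X \<omega>))\<^sup>2 + (norm (Y \<omega>))\<^sup>2)"
    by (simp add: abs_of_nonneg)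
qed measurable

text \<open>Each coordinate of \<open>X\<close> is \<open>F\<close>-measurable and may be pulled
  into the conditional expectation; square integrability makes the coordinate products
  integrable.\<close>

lemma (in sigma_finite_subalgebra) integral_inner_vec_cond_exp:
  fixes X Y :: "'a \<Rightarrow> 'e::euclidean_space"
  assumes X: "X \<in> borel_measurable F" and Y: "Y \<in> borel_measurable M"
    and sq: "integrable M (\<lambda>\<omega>. (norm (X \<omega>))\<^sup>2)" "integrable M (\<lambda>\<omega>. (norm (Y \<omega>))\<^sup>2)"
  shows "(\<integral>\<omega>. X \<omega> \<bullet> vec_cond_exp M F Y \<omega> \<partial>M) = (\<integral>\<omega>. X \<omega> \<bullet> Y \<omega> \<partial>M)"
proof -
  have XM: "X \<in> borel_measurable M" by (rule measurable_from_subalg[OF subalg X])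
  have int: "integrable M (\<lambda>\<omega>. (X \<omega> \<bullet> b) * (Y \<omega> \<bullet> b))" if b: "b \<in> Basis" for b
  proof -
    have coord: "integrable M (\<lambda>\<omega>. (norm (Z \<omega> \<bullet> b))\<^sup>2)"
      if [measurable]: "Z \<in> borel_measurable M" and "integrable M (\<lambda>\<omega>. (norm (Z \<omega>))\<^sup>2)"
      for Z :: "'a \<Rightarrow> 'e"
      by (rule Bochner_Integration.integrable_bound[OF that(2)])
        (use Basis_le_norm[OF b] in \<open>auto simp: abs_le_square_iff[symmetric]\<close>)
    have "integrable M (\<lambda>\<omega>. (X \<omega> \<bullet> b) \<bullet> (Y \<omega> \<bullet> b))"
      by (intro integrable_inner_of_square_integrable coord sq borel_measurable_inner
          borel_measurable_const XM Y)
    then show ?thesis by simp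
  qed
  have cond: "integrable M (\<lambda>\<omega>. (X \<omega> \<bullet> b) * real_cond_exp M F (\<lambda>\<omega>. Y \<omega> \<bullet> b) \<omega>)"
    "(\<integral>\<omega>. (X \<omega> \<bullet> b) * real_cond_exp M F (\<lambda>\<omega>. Y \<omega> \<bullet> b) \<omega> \<partial>M) = (\<integral>\<omega>. (X \<omega> \<bullet> b) * (Y \<omega> \<bullet> b) \<partial>M)"
    if "b \<in> Basis" for b
    using X Y by (intro real_cond_exp_intg int[OF that]; measurable)+
  have "(\<integral>\<omega>. X \<omega> \<bullet> vec_cond_exp M F Y \<omega> \<partial>M)
      = (\<integral>\<omega>. (\<Sum>b\<in>Basis. (X \<omega> \<bullet> b) * real_cond_exp M F (\<lambda>\<omega>. Y \<omega> \<bullet> b) \<omega>) \<partial>M)"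
    by (simp add: vec_cond_exp_def inner_sum_right mult.commute)
  also have "\<dots> = (\<Sum>b\<in>Basis. \<integral>\<omega>. (X \<omega> \<bullet> b) * (Y \<omega> \<bullet> b) \<partial>M)"
    using cond by (subst Bochner_Integration.integral_sum) auto
  also have "\<dots> = (\<integral>\<omega>. (\<Sum>b\<in>Basis. (X \<omega> \<bullet> b) * (Y \<omega> \<bullet> b)) \<partial>M)"
    using int by (intro Bochner_Integration.integral_sum[symmetric]) auto
  also have "\<dots> = (\<integral>\<omega>. X \<omega> \<bullet> Y \<omega> \<partial>M)" by (simp add: euclidean_inner[symmetric])
  finally show ?thesis .
qed

text \<open>The tower property holds in the extended nonnegative reals without integrability of
  \<open>f\<close>; the finite bound then yields integrability as part of the conclusion.\<close>

lemma (in sigma_finite_subalgebra) integral_le_of_nn_cond_exp_le: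
  assumes [measurable]: "f \<in> borel_measurable M" and f: "\<And>\<omega>. 0 \<le> f \<omega>"
    and h: "integrable M h" "AE \<omega> in M. 0 \<le> h \<omega>"
    and le: "AE \<omega> in M. nn_cond_exp M F (\<lambda>\<omega>. ennreal (f \<omega>)) \<omega> \<le> ennreal (h \<omega>)"
  shows "integrable M f" "(\<integral>\<omega>. f \<omega> \<partial>M) \<le> (\<integral>\<omega>. h \<omega> \<partial>M)"
proof -
  have "(\<integral>\<^sup>+\<omega>. ennreal (f \<omega>) \<partial>M) = (\<integral>\<^sup>+\<omega>. nn_cond_exp M F (\<lambda>\<omega>. ennreal (f \<omega>)) \<omega> \<partial>M)"
    using nn_cond_exp_intg[of "\<lambda>_. 1" "\<lambda>\<omega>. ennreal (f \<omega>)"] by simp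
  also have "\<dots> \<le> (\<integral>\<^sup>+\<omega>. ennreal (h \<omega>) \<partial>M)" by (rule nn_integral_mono_AE[OF le])
  also have "\<dots> = ennreal (\<integral>\<omega>. h \<omega> \<partial>M)" by (rule nn_integral_eq_integral[OF h])
  finally have bound: "(\<integral>\<^sup>+\<omega>. ennreal (f \<omega>) \<partial>M) \<le> ennreal (\<integral>\<omega>. h \<omega> \<partial>M)" .
  show int: "integrable M f"
    using bound f by (intro integrableI_nonneg) (auto intro: le_less_trans)
  have "ennreal (\<integral>\<omega>. f \<omega> \<partial>M) \<le> ennreal (\<integral>\<omega>. h \<omega> \<partial>M)"
    using bound f by (simp add: nn_integral_eq_integral[OF int])
  then show "(\<integral>\<omega>. f \<omega> \<partial>M) \<le> (\<integral>\<omega>. h \<omega> \<partial>M)"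
    using integral_nonneg_AE[OF h(2)] by (simp add: ennreal_le_iff)
qed

theorem theoremB1:
  fixes L :: "'a::euclidean_space \<Rightarrow> 'b::euclidean_space"
    and F :: "'a \<Rightarrow> real" and R :: "'a \<Rightarrow> ereal" and H :: "'b \<Rightarrow> ereal"
    and xs ps p0 :: 'a and ys y0 :: 'b
    and M :: "'w measure" and Fil :: "nat \<Rightarrow> 'w measure"
    and x w p g :: "nat \<Rightarrow> 'w \<Rightarrow> 'a" and y :: "nat \<Rightarrow> 'w \<Rightarrow> 'b"
    and \<sigma> V :: "nat \<Rightarrow> 'w \<Rightarrow> real"
    and \<gamma> \<tau> \<nu> lam \<alpha> \<beta> \<delta> \<rho> \<kappa> \<mu>F \<mu>R \<mu>H \<mu> \<sigma>0 r :: real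
  assumes L: "linear L"
    and F: "convex_on UNIV F" "\<nu> > 0" "smooth_fun \<nu> F"
    and R: "proper_fun R" "ext_convex R" "lower_semicont R"
    and H: "proper_fun H" "ext_convex H" "lower_semicont H"
    and xs: "0 \<in> {grad F xs + u + adjoint L ys | u. u \<in> subdiff R xs}"
    and ys: "L xs \<in> subdiff (conjugate H) ys"
    and ps: "ps = xs - \<gamma> *\<^sub>R grad F xs - \<gamma> *\<^sub>R adjoint L ys"
    and M: "prob_space M" "\<And>k. subalgebra M (Fil k)" "filtration (space M) Fil"
    and pos: "\<gamma> > 0" "\<tau> > 0"
    and init: "\<And>\<omega>. \<omega> \<in> space M \<Longrightarrow> p 0 \<omega> = p0"
      "\<And>\<omega>. \<omega> \<in> space M \<Longrightarrow> y 0 \<omega> = y0"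
      "\<And>\<omega>. \<omega> \<in> space M \<Longrightarrow> \<sigma> 0 \<omega> = \<sigma>0"
    and iter_x: "\<And>k \<omega>. \<omega> \<in> space M \<Longrightarrow> x k \<omega> = prox (\<lambda>u. ereal \<gamma> * R u) (p k \<omega>)"
    and iter_w: "\<And>k \<omega>. \<omega> \<in> space M \<Longrightarrow>
      w k \<omega> = 2 *\<^sub>R x k \<omega> - p k \<omega> - \<gamma> *\<^sub>R g (Suc k) \<omega>"
    and iter_y: "\<And>k \<omega>. \<omega> \<in> space M \<Longrightarrow>
      y (Suc k) \<omega> = prox (\<lambda>v. ereal \<tau> * conjugate H v)
        (y k \<omega> + \<tau> *\<^sub>R L (w k \<omega> - \<gamma> *\<^sub>R adjoint L (y k \<omega>)))"
    and iter_p: "\<And>k \<omega>. \<omega> \<in> space M \<Longrightarrow>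
      p (Suc k) \<omega> = x k \<omega> - \<gamma> *\<^sub>R g (Suc k) \<omega> - \<gamma> *\<^sub>R adjoint L (y (Suc k) \<omega>)"
    and sg: "stochastic_gradient M Fil F xs x g \<sigma> \<alpha> \<beta> \<delta> \<rho>"
    and H_smooth: "\<mu>H > 0" "ext_smooth (1 / \<mu>H) H"
    and F_sc: "\<mu>F \<ge> 0" "strongly_convex \<mu>F (\<lambda>u. ereal (F u))"
    and R_sc: "\<mu>R \<ge> 0" "strongly_convex \<mu>R R"
    and \<mu>: "\<mu> = \<mu>F + 2 * \<mu>R" "\<mu> > 0"
    and R_smooth: "lam > 0" "ext_smooth lam R"
    and \<kappa>: "\<kappa> > \<beta> / \<rho>"
    and step: "\<alpha> + \<kappa> * \<delta> \<noteq> 0 \<Longrightarrow> \<gamma> \<le> 1 / (\<alpha> + \<kappa> * \<delta>)"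
      "\<gamma> * \<tau> * (onorm L)\<^sup>2 < 1"
    and V: "\<And>k \<omega>. V k \<omega> = (norm (p k \<omega> - ps))\<^sup>2
      + (1 + 2 * \<tau> * \<mu>H) * dual_norm_sq L \<gamma> \<tau> (y k \<omega> - ys) + \<kappa> * \<gamma>\<^sup>2 * (\<sigma> k \<omega>)\<^sup>2"
    and r: "r = Max {1 - \<gamma> * \<mu> / (1 + \<gamma> * lam)\<^sup>2, 1 - \<rho> + \<beta> / \<kappa>, 1 / (1 + 2 * \<tau> * \<mu>H)}"
  shows "\<forall>k. integrable M (V k) \<and>
    (\<forall>\<omega>\<in>space M. prob_space.expectation M (V k) \<le> r ^ k * V 0 \<omega>)"
proof -

  \<comment> \<open>Unpacking the hypotheses: real-valued \<open>R\<close> and \<open>H\<close>,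
    stochastic bounds, constants\<close>
  interpret prob_space M by (rule M(1))
  interpret filtration "space M" Fil by (rule M(3))
  have sub: "sigma_finite_subalgebra M (Fil k)" for k
    using M(2)[of k] finite_measure_axioms
    by (intro finite_measure_subalgebra_is_sigma_finite)
      (simp add: finite_measure_subalgebra_def finite_measure_subalgebra_axioms_def)
  obtain f where Rf: "R = (\<lambda>u. ereal (f u))" and fs: "smooth_fun lam f"
    using R_smooth(2) unfolding ext_smooth_def by auto
  obtain h where Hh: "H = (\<lambda>v. ereal (h v))" and hs: "smooth_fun (1 / \<mu>H) h"
    using H_smooth(2) unfolding ext_smooth_def by auto
  have fc: "convex_on UNIV f" using R(2) unfolding Rf ext_convex_ereal_iff .
  have hc: "convex_on UNIV h" using H(2) unfolding Hh ext_convex_ereal_iff .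
  note fD = smooth_funD[OF fs] and hD = smooth_funD[OF hs] and FD = smooth_funD[OF F(3)]
  from sg have g0: "0 \<le> \<alpha>" "0 \<le> \<beta>" "0 \<le> \<delta>" "0 < \<rho>" "\<rho> \<le> 1"
    and g_meas: "\<And>k. g (Suc k) \<in> borel_measurable (Fil (Suc k))"
    and \<sigma>_meas: "\<And>k. \<sigma> k \<in> borel_measurable (Fil k)"
    and g_mean: "\<And>k. AE \<omega> in M. vec_cond_exp M (Fil k) (g (Suc k)) \<omega> = grad F (x k \<omega>)"
    and g_var: "\<And>k. AE \<omega> in M.
       nn_cond_exp M (Fil k) (\<lambda>\<omega>'. ennreal ((norm (g (Suc k) \<omega>' - grad F xs))\<^sup>2)) \<omega>
         \<le> ennreal (2 * \<alpha> * bregman F (x k \<omega>) xs + \<beta> * (\<sigma> k \<omega>)\<^sup>2)"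
    and \<sigma>_var: "\<And>k. AE \<omega> in M.
       nn_cond_exp M (Fil k) (\<lambda>\<omega>'. ennreal ((\<sigma> (Suc k) \<omega>')\<^sup>2)) \<omega>
         \<le> ennreal ((1 - \<rho>) * (\<sigma> k \<omega>)\<^sup>2 + 2 * \<delta> * bregman F (x k \<omega>) xs)"
    unfolding stochastic_gradient_def by simp_all
  have "0 \<le> \<beta> / \<rho>" using g0 by simp
  then have \<kappa>0: "0 < \<kappa>" using \<kappa> by linarith
  \<comment> \<open>Multiplied out, the condition also covers a zero denominator, where the product
    is 0.\<close>
  have stepsize: "\<gamma> * (\<alpha> + \<kappa> * \<delta>) \<le> 1"
  proof (cases "\<alpha> + \<kappa> * \<delta> = 0")
    case False
    moreover have "0 \<le> \<alpha> + \<kappa> * \<delta>" using g0 \<kappa>0 by simp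
    ultimately show ?thesis using step(1) by (simp add: pos_le_divide_eq)
  qed simp
  have r_ge: "1 - \<gamma> * \<mu> / (1 + \<gamma> * lam)\<^sup>2 \<le> r" "1 - \<rho> + \<beta> / \<kappa> \<le> r" "1 / (1 + 2 * \<tau> * \<mu>H) \<le> r"
    unfolding r by simp_all
  have "0 < 1 / (1 + 2 * \<tau> * \<mu>H)" using pos H_smooth(1) by (simp add: add_pos_pos)
  then have r0: "0 \<le> r" using r_ge(3) by linarith
  note step2 = less_imp_le[OF step(2)]
  note d_nonneg = dual_norm_sq_bounds(1)[OF L pos step2]

  \<comment> \<open>Continuity of the proximal maps and optimality in gradient form\<close>
  define prR where "prR = prox (\<lambda>u. ereal \<gamma> * R u)"
  define prH where "prH = prox (\<lambda>v. ereal \<tau> * conjugate H v)"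
  have prR_cont: "continuous_on UNIV prR"
    unfolding prR_def Rf using fc fD(1,4) pos by (intro continuous_on_prox_gradient) auto
  have prH_cont: "continuous_on UNIV prH"
    unfolding prH_def Hh using hc hD(1,4) pos by (intro continuous_on_prox_conjugate) auto

  obtain us where us: "us \<in> subdiff R xs" "0 = grad F xs + us + adjoint L ys"
    using xs by blast
  have us_eq: "grad f xs = - grad F xs - adjoint L ys"
  proof -
    have "us = grad f xs" using us(1) fD(1) unfolding Rf by (rule subdiff_gradient)
    with us(2) show ?thesis by (simp add: algebra_simps eq_neg_iff_add_eq_0)
  qed
  have ys_eq: "ys = grad h (L xs)"
    using hc hD(1) ys unfolding Hh by (rule subdiff_conjugate_gradient)

  \<comment> \<open>Deviations from the solution and their pathwise bounds\<close>
  define X where "X k \<omega> = x k \<omega> - xs" for k \<omega>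
  define Q where "Q k \<omega> = grad f (x k \<omega>) - grad f xs" for k \<omega>
  define G where "G k \<omega> = g (Suc k) \<omega> - grad F xs" for k \<omega>
  define E where "E k \<omega> = grad F (x k \<omega>) - grad F xs" for k \<omega>
  define D where "D k \<omega> = bregman F (x k \<omega>) xs" for k \<omega>
  define d where "d k \<omega> = dual_norm_sq L \<gamma> \<tau> (y k \<omega> - ys)" for k \<omega>

  have p_X: "p k \<omega> - ps = X k \<omega> + \<gamma> *\<^sub>R Q k \<omega>" if \<omega>: "\<omega> \<in> space M" for k \<omega>
  proof -
    have "p k \<omega> = x k \<omega> + \<gamma> *\<^sub>R grad f (x k \<omega>)"
      using iter_x[OF \<omega>, of k] pos unfolding Rf by (intro prox_gradient[OF fc fD(1,4)]) auto
    then show ?thesis unfolding ps X_def Q_def us_eq by (simp add: algebra_simps)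
  qed
  \<comment> \<open>The tangent inequalities in both directions contribute half of the modulus
    each.\<close>
  have XQ: "\<mu>R * (norm (X k \<omega>))\<^sup>2 \<le> X k \<omega> \<bullet> Q k \<omega>" for k \<omega>
    using strongly_convex_tangent_le[OF R_sc(2)[unfolded Rf] fD(1), of xs "x k \<omega>"]
      strongly_convex_tangent_le[OF R_sc(2)[unfolded Rf] fD(1), of "x k \<omega>" xs]
    unfolding X_def Q_def
    by (simp add: norm_minus_commute[of xs] inner_diff inner_commute algebra_simps)
  have Q_le: "norm (Q k \<omega>) \<le> lam * norm (X k \<omega>)" for k \<omega>
    unfolding X_def Q_def by (rule fD(2))
  have E_le: "norm (E k \<omega>) \<le> \<nu> * norm (X k \<omega>)" for k \<omega>
    unfolding X_def E_def by (rule FD(2))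
  \<comment> \<open>The tangent at \<open>x k\<close> alone is used, since the opposite gap is the
    Bregman divergence itself. This gives half the modulus, against the full one in
    \<open>XQ\<close>, whence \<mu> weighs \<open>\<mu>R\<close> twice.\<close>
  have XE: "D k \<omega> + \<mu>F / 2 * (norm (X k \<omega>))\<^sup>2 \<le> X k \<omega> \<bullet> E k \<omega>" for k \<omega>
    using strongly_convex_tangent_le[OF F_sc(2) FD(1), of "x k \<omega>" xs]
    unfolding X_def E_def D_def bregman_def
    by (simp add: norm_minus_commute[of xs] inner_diff inner_commute algebra_simps)
  have D0: "0 \<le> D k \<omega>" for k \<omega>
    using convex_on_tangent_le[OF F(1) FD(1), of xs "x k \<omega>"] unfolding D_def bregman_def by simp
  have p_sq: "(norm (p k \<omega> - ps))\<^sup>2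
      = (norm (X k \<omega>))\<^sup>2 + 2 * \<gamma> * (X k \<omega> \<bullet> Q k \<omega>) + \<gamma>\<^sup>2 * (norm (Q k \<omega>))\<^sup>2"
    if "\<omega> \<in> space M" for k \<omega>
    unfolding p_X[OF that] power2_norm_eq_inner
    by (simp add: inner_add_left inner_add_right inner_commute power2_eq_square)
  have p_le: "(norm (p k \<omega> - ps))\<^sup>2 \<le> (1 + \<gamma> * lam)\<^sup>2 * (norm (X k \<omega>))\<^sup>2" if "\<omega> \<in> space M" for k \<omega>
  proof -
    have "norm (p k \<omega> - ps) \<le> norm (X k \<omega>) + \<gamma> * norm (Q k \<omega>)"
      unfolding p_X[OF that] using pos norm_triangle_ineq[of "X k \<omega>" "\<gamma> *\<^sub>R Q k \<omega>"] by simp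
    also have "\<dots> \<le> norm (X k \<omega>) + \<gamma> * (lam * norm (X k \<omega>))"
      using pos by (intro add_left_mono mult_left_mono Q_le) simp
    also have "\<dots> = (1 + \<gamma> * lam) * norm (X k \<omega>)" by (simp add: algebra_simps)
    finally show ?thesis by (metis norm_ge_zero power_mono power_mult_distrib)
  qed
  have X_le: "(norm (X k \<omega>))\<^sup>2 \<le> (norm (p k \<omega> - ps))\<^sup>2" if "\<omega> \<in> space M" for k \<omega>
  proof -
    have "0 \<le> \<mu>R * (norm (X k \<omega>))\<^sup>2" using R_sc(1) by simp
    then have "0 \<le> X k \<omega> \<bullet> Q k \<omega>" using XQ[of k \<omega>] by linarith
    then show ?thesis using p_sq[OF that, of k] pos by simp
  qed

  \<comment> \<open>One iteration, pathwise\<close>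
  have V_Suc: "V (Suc k) \<omega> \<le> (norm (X k \<omega> - \<gamma> *\<^sub>R G k \<omega>))\<^sup>2 + \<gamma>\<^sup>2 * (norm (Q k \<omega>))\<^sup>2 + d k \<omega>
      + \<kappa> * \<gamma>\<^sup>2 * (\<sigma> (Suc k) \<omega>)\<^sup>2" if \<omega>: "\<omega> \<in> space M" for k \<omega>
  proof -
    let ?Y = "y k \<omega> - ys" and ?Y' = "y (Suc k) \<omega> - ys"
    obtain u where u: "y (Suc k) \<omega> = grad h u"
      "y k \<omega> + \<tau> *\<^sub>R L (w k \<omega> - \<gamma> *\<^sub>R adjoint L (y k \<omega>)) = y (Suc k) \<omega> + \<tau> *\<^sub>R u"
      using prox_conjugate_gradient[OF hc hD(1,4) pos(2)] iter_y[OF \<omega>, of k] unfolding Hh by metis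
    \<comment> \<open>Substituting \<open>p k\<close> and \<open>ps\<close> makes the contributions
      of \<open>grad F xs\<close> and \<open>adjoint L ys\<close> combine into the deviations,
      leaving only the shift \<open>xs\<close>.\<close>
    have arg: "w k \<omega> - \<gamma> *\<^sub>R adjoint L (y k \<omega>)
        = (X k \<omega> - \<gamma> *\<^sub>R Q k \<omega> - \<gamma> *\<^sub>R G k \<omega> - \<gamma> *\<^sub>R adjoint L ?Y) + xs"
      using p_X[OF \<omega>, of k] unfolding iter_w[OF \<omega>] ps X_def G_def
      by (simp add: linear_diff[OF adjoint_linear[OF L]] algebra_simps scaleR_2)
    have dual: "?Y' + \<tau> *\<^sub>R (u - L xs)
        = ?Y + \<tau> *\<^sub>R L (X k \<omega> - \<gamma> *\<^sub>R Q k \<omega> - \<gamma> *\<^sub>R G k \<omega> - \<gamma> *\<^sub>R adjoint L ?Y)"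
      using u(2) unfolding arg linear_add[OF L] by (simp add: algebra_simps)
    have "(norm ?Y')\<^sup>2 \<le> 1 / \<mu>H * (?Y' \<bullet> (u - L xs))"
      unfolding u(1) ys_eq using H_smooth(1) by (intro gradient_cocoercive[OF hc hD(1) _ hD(2)]) simp
    then have mono: "\<mu>H * (norm ?Y')\<^sup>2 \<le> ?Y' \<bullet> (u - L xs)"
      using H_smooth(1) by (simp add: field_simps)
    have "p (Suc k) \<omega> - ps = X k \<omega> - \<gamma> *\<^sub>R G k \<omega> - \<gamma> *\<^sub>R adjoint L ?Y'"
      unfolding iter_p[OF \<omega>] ps X_def G_def
      by (simp add: linear_diff[OF adjoint_linear[OF L]] algebra_simps)
    then show ?thesis
      using pd3o_step_descent[OF L pos step2 dual less_imp_le[OF H_smooth(1)] mono]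
      unfolding V d_def by simp
  qed

  \<comment> \<open>The left side is the expanded bound of \<open>V_Suc\<close> with
    \<open>E\<close> in place of \<open>G\<close> in the cross term and the conditional bounds in
    place of the squares of \<open>G\<close> and of the next \<sigma>.\<close>
  have pointwise: "(norm (X k \<omega>))\<^sup>2 - 2 * \<gamma> * (X k \<omega> \<bullet> E k \<omega>)
      + \<gamma>\<^sup>2 * (2 * \<alpha> * D k \<omega> + \<beta> * (\<sigma> k \<omega>)\<^sup>2) + \<gamma>\<^sup>2 * (norm (Q k \<omega>))\<^sup>2 + d k \<omega>
      + \<kappa> * \<gamma>\<^sup>2 * ((1 - \<rho>) * (\<sigma> k \<omega>)\<^sup>2 + 2 * \<delta> * D k \<omega>) \<le> r * V k \<omega>"
    if "\<omega> \<in> space M" for k \<omega>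
    unfolding V d_def
    by (rule lyapunov_contraction[OF p_sq[OF that] p_le[OF that] XE XQ])
      (use D0 d_nonneg F_sc(1) R_sc(1) pos R_smooth(1) \<kappa>0 H_smooth(1) stepsize r_ge
        in \<open>simp_all add: \<mu>(1)\<close>)

  \<comment> \<open>Adaptedness and measurability of the iterates\<close>
  have Fil_mono: "h' \<in> borel_measurable (Fil (Suc k))" if "h' \<in> borel_measurable (Fil k)"
    for h' :: "'w \<Rightarrow> 'z::topological_space" and k
    by (rule measurable_from_subalg[OF _ that])
      (simp add: subalgebra_def space_F sets_F_mono)
  have FilM: "h' \<in> borel_measurable M" if "h' \<in> borel_measurable (Fil k)"
    for h' :: "'w \<Rightarrow> 'z::topological_space" and k
    by (rule measurable_from_subalg[OF M(2) that])
  have L_cont: "continuous_on UNIV L" "continuous_on UNIV (adjoint L)"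
    using L adjoint_linear[OF L] by (simp_all add: linear_continuous_on linear_conv_bounded_linear)
  \<comment> \<open>The iteration equations hold only on \<open>space M\<close>, so measurability is
    shown for the explicit formula and transferred by \<open>measurable_cong\<close>.\<close>
  have x_of_p: "x k \<in> borel_measurable (Fil k)" if "p k \<in> borel_measurable (Fil k)" for k
  proof -
    have "(\<lambda>\<omega>. prR (p k \<omega>)) \<in> borel_measurable (Fil k)"
      by (rule borel_measurable_continuous_on[OF prR_cont that])
    then show ?thesis
      by (rule iffD1[OF measurable_cong, rotated]) (simp add: space_F iter_x prR_def)
  qed
  have py_meas: "p k \<in> borel_measurable (Fil k) \<and> y k \<in> borel_measurable (Fil k)" for k
  proof (induction k)
    case 0
    have "p 0 \<in> borel_measurable (Fil 0) \<longleftrightarrow> (\<lambda>_. p0) \<in> borel_measurable (Fil 0)"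
      "y 0 \<in> borel_measurable (Fil 0) \<longleftrightarrow> (\<lambda>_. y0) \<in> borel_measurable (Fil 0)"
      using init by (intro measurable_cong; simp add: space_F)+
    then show ?case by simp
  next
    case (Suc k)
    note [measurable] = g_meas[of k] borel_measurable_continuous_on[OF L_cont(1)]
      borel_measurable_continuous_on[OF L_cont(2)] borel_measurable_continuous_on[OF prH_cont]
    have [measurable]: "p k \<in> borel_measurable (Fil (Suc k))" "y k \<in> borel_measurable (Fil (Suc k))"
      "x k \<in> borel_measurable (Fil (Suc k))"
      using Suc x_of_p by (auto intro: Fil_mono)
    have "(\<lambda>\<omega>. prH (y k \<omega> + \<tau> *\<^sub>R L (2 *\<^sub>R x k \<omega> - p k \<omega> - \<gamma> *\<^sub>R g (Suc k) \<omega>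
        - \<gamma> *\<^sub>R adjoint L (y k \<omega>)))) \<in> borel_measurable (Fil (Suc k))"
      by measurable
    then have y[measurable]: "y (Suc k) \<in> borel_measurable (Fil (Suc k))"
      by (rule iffD1[OF measurable_cong, rotated]) (simp add: space_F iter_y iter_w prH_def)
    have "(\<lambda>\<omega>. x k \<omega> - \<gamma> *\<^sub>R g (Suc k) \<omega> - \<gamma> *\<^sub>R adjoint L (y (Suc k) \<omega>))
        \<in> borel_measurable (Fil (Suc k))"
      by measurable
    then have "p (Suc k) \<in> borel_measurable (Fil (Suc k))"
      by (rule iffD1[OF measurable_cong, rotated]) (simp add: space_F iter_p)
    with y show ?case by simp
  qed
  have x_meas: "x k \<in> borel_measurable (Fil k)" for k
    using x_of_p py_meas by blast
  have [measurable]: "p k \<in> borel_measurable M" "y k \<in> borel_measurable M" "x k \<in> borel_measurable M"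
    "g (Suc k) \<in> borel_measurable M" "\<sigma> k \<in> borel_measurable M" for k
    using py_meas x_meas g_meas \<sigma>_meas FilM by blast+
  \<comment> \<open>Measurability with respect to \<open>Fil k\<close>, and not merely
    \<open>M\<close>, is what allows \<open>X k\<close> to be pulled out of the conditional
    expectation.\<close>
  have X_meas: "X k \<in> borel_measurable (Fil k)" for k
    unfolding X_def using x_meas by simp
  have [measurable]: "X k \<in> borel_measurable M" "Q k \<in> borel_measurable M" "G k \<in> borel_measurable M"
    "E k \<in> borel_measurable M" "D k \<in> borel_measurable M" "d k \<in> borel_measurable M"
    "V k \<in> borel_measurable M" for k
  proof -
    note [measurable] = borel_measurable_continuous_on[OF L_cont(2)]
      borel_measurable_continuous_on[OF fD(3)] borel_measurable_continuous_on[OF FD(3)]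
      borel_measurable_continuous_on[OF FD(4)]
    show "X k \<in> borel_measurable M" "Q k \<in> borel_measurable M" "G k \<in> borel_measurable M"
      "E k \<in> borel_measurable M" "D k \<in> borel_measurable M"
      unfolding X_def Q_def G_def E_def D_def bregman_def by measurable
    show d[measurable]: "d k \<in> borel_measurable M"
      unfolding d_def dual_norm_sq_def by measurable
    show "V k \<in> borel_measurable M"
      unfolding V d_def[symmetric] by measurable
  qed

  \<comment> \<open>One iteration, in expectation\<close>
  have contraction: "integrable M (V (Suc k)) \<and> expectation (V (Suc k)) \<le> r * expectation (V k)"
    if V_int: "integrable M (V k)" for k
  proof -
    interpret S: sigma_finite_subalgebra M "Fil k" by (rule sub)
    have d0: "0 \<le> d k \<omega>" for \<omega> unfolding d_def by (rule d_nonneg)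
    have c0: "0 \<le> \<tau> * \<mu>H" "0 < \<kappa> * \<gamma>\<^sup>2" using pos H_smooth(1) \<kappa>0 by auto
    have d1: "0 \<le> 2 * \<tau> * \<mu>H * d k \<omega>" for \<omega>
      using mult_nonneg_nonneg[OF c0(1) d0[of \<omega>]] by (simp add: mult.assoc)
    have s0: "0 \<le> \<kappa> * \<gamma>\<^sup>2 * (\<sigma> k \<omega>)\<^sup>2" for \<omega>
      using \<kappa>0 by simp
    \<comment> \<open>Splitting off one copy of \<open>d k\<close> displays \<open>V k\<close> as a
      sum of nonnegative terms, so its integrability passes to each of them.\<close>
    have V_split: "V k \<omega> = (norm (p k \<omega> - ps))\<^sup>2 + d k \<omega> + 2 * \<tau> * \<mu>H * d k \<omega> + \<kappa> * \<gamma>\<^sup>2 * (\<sigma> k \<omega>)\<^sup>2" for \<omega>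
      unfolding V d_def by (simp add: distrib_right)
    note bounds = V_split d0 d1 s0
    have dom: "integrable M q" if "q \<in> borel_measurable M" "integrable M B"
      "\<And>\<omega>. \<omega> \<in> space M \<Longrightarrow> \<bar>q \<omega>\<bar> \<le> B \<omega>" for q B :: "'w \<Rightarrow> real"
      by (rule Bochner_Integration.integrable_bound[OF that(2,1)]) (use that(3) in force)
    have X_int: "integrable M (\<lambda>\<omega>. (norm (X k \<omega>))\<^sup>2)"
    proof (rule dom[OF _ V_int])
      fix \<omega> assume "\<omega> \<in> space M"
      then show "\<bar>(norm (X k \<omega>))\<^sup>2\<bar> \<le> V k \<omega>"
        using bounds[of \<omega>] X_le[of \<omega> k] zero_le_power2[of "norm (X k \<omega>)"] by linarith
    qed measurable
    have d_int: "integrable M (d k)"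
    proof (rule dom[OF _ V_int])
      show "\<bar>d k \<omega>\<bar> \<le> V k \<omega>" for \<omega>
        using bounds[of \<omega>] zero_le_power2[of "norm (p k \<omega> - ps)"] by linarith
    qed measurable
    have "integrable M (\<lambda>\<omega>. \<kappa> * \<gamma>\<^sup>2 * (\<sigma> k \<omega>)\<^sup>2)"
    proof (rule dom[OF _ V_int])
      show "\<bar>\<kappa> * \<gamma>\<^sup>2 * (\<sigma> k \<omega>)\<^sup>2\<bar> \<le> V k \<omega>" for \<omega>
        using bounds[of \<omega>] zero_le_power2[of "norm (p k \<omega> - ps)"] by linarith
    qed measurable
    then have \<sigma>_int: "integrable M (\<lambda>\<omega>. (\<sigma> k \<omega>)\<^sup>2)" using c0 \<kappa>0 pos by simp
    have sq_le: "integrable M (\<lambda>\<omega>. (norm (Z \<omega>))\<^sup>2)"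
      if "Z \<in> borel_measurable M" "\<And>\<omega>. norm (Z \<omega>) \<le> c * norm (X k \<omega>)" for Z :: "'w \<Rightarrow> 'a" and c
    proof (rule dom)
      show "integrable M (\<lambda>\<omega>. c\<^sup>2 * (norm (X k \<omega>))\<^sup>2)" using X_int by simp
      show "\<bar>(norm (Z \<omega>))\<^sup>2\<bar> \<le> c\<^sup>2 * (norm (X k \<omega>))\<^sup>2" for \<omega>
        using power_mono[OF that(2)[of \<omega>], of 2] by (simp add: power_mult_distrib)
    qed (use that(1) in measurable)
    have Q_int: "integrable M (\<lambda>\<omega>. (norm (Q k \<omega>))\<^sup>2)" by (rule sq_le[OF _ Q_le]) measurable
    have E_int: "integrable M (\<lambda>\<omega>. (norm (E k \<omega>))\<^sup>2)" by (rule sq_le[OF _ E_le]) measurable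
    have XE_int: "integrable M (\<lambda>\<omega>. X k \<omega> \<bullet> E k \<omega>)"
      by (rule integrable_inner_of_square_integrable[OF _ _ X_int E_int]) measurable
    have D_int: "integrable M (D k)"
    proof (rule dom[OF _ XE_int])
      fix \<omega>
      have "0 \<le> \<mu>F / 2 * (norm (X k \<omega>))\<^sup>2" using F_sc(1) by simp
      then show "\<bar>D k \<omega>\<bar> \<le> X k \<omega> \<bullet> E k \<omega>" using XE[of k \<omega>] D0[of k \<omega>] by linarith
    qed measurable
    have G_int: "integrable M (\<lambda>\<omega>. (norm (G k \<omega>))\<^sup>2)"
      and G_le: "(\<integral>\<omega>. (norm (G k \<omega>))\<^sup>2 \<partial>M) \<le> (\<integral>\<omega>. 2 * \<alpha> * D k \<omega> + \<beta> * (\<sigma> k \<omega>)\<^sup>2 \<partial>M)"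
      using S.integral_le_of_nn_cond_exp_le[of "\<lambda>\<omega>. (norm (G k \<omega>))\<^sup>2"
          "\<lambda>\<omega>. 2 * \<alpha> * D k \<omega> + \<beta> * (\<sigma> k \<omega>)\<^sup>2"] D_int \<sigma>_int g0 D0 g_var[of k]
      by (simp_all add: G_def[symmetric] D_def[symmetric])
    have \<sigma>'_int: "integrable M (\<lambda>\<omega>. (\<sigma> (Suc k) \<omega>)\<^sup>2)"
      and \<sigma>'_le: "(\<integral>\<omega>. (\<sigma> (Suc k) \<omega>)\<^sup>2 \<partial>M) \<le> (\<integral>\<omega>. (1 - \<rho>) * (\<sigma> k \<omega>)\<^sup>2 + 2 * \<delta> * D k \<omega> \<partial>M)"
      using S.integral_le_of_nn_cond_exp_le[of "\<lambda>\<omega>. (\<sigma> (Suc k) \<omega>)\<^sup>2"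
          "\<lambda>\<omega>. (1 - \<rho>) * (\<sigma> k \<omega>)\<^sup>2 + 2 * \<delta> * D k \<omega>"] D_int \<sigma>_int g0 D0 \<sigma>_var[of k]
      by (simp_all add: D_def[symmetric])
    have XG_int: "integrable M (\<lambda>\<omega>. X k \<omega> \<bullet> G k \<omega>)"
      by (rule integrable_inner_of_square_integrable[OF _ _ X_int G_int]) measurable
    \<comment> \<open>Unbiasedness concerns \<open>g (Suc k)\<close> itself, so its square
      integrability is derived first and the constant \<open>grad F xs\<close> is subtracted from
      both sides at the end.\<close>
    have XG: "(\<integral>\<omega>. X k \<omega> \<bullet> G k \<omega> \<partial>M) = (\<integral>\<omega>. X k \<omega> \<bullet> E k \<omega> \<partial>M)"
    proof -
      let ?c = "grad F xs"
      have c_int: "integrable M (\<lambda>\<omega>. X k \<omega> \<bullet> ?c)"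
        by (rule integrable_inner_of_square_integrable[OF _ _ X_int]) simp_all
      have "integrable M (\<lambda>\<omega>. (norm (g (Suc k) \<omega>))\<^sup>2)"
      proof (rule dom)
        show "integrable M (\<lambda>\<omega>. 2 * (norm (G k \<omega>))\<^sup>2 + 2 * (norm ?c)\<^sup>2)" using G_int by simp
        show "\<bar>(norm (g (Suc k) \<omega>))\<^sup>2\<bar> \<le> 2 * (norm (G k \<omega>))\<^sup>2 + 2 * (norm ?c)\<^sup>2" for \<omega>
        proof -
          \<comment> \<open>Parallelogram identity.\<close>
          have "(norm (G k \<omega> + ?c))\<^sup>2 + (norm (G k \<omega> - ?c))\<^sup>2 = 2 * (norm (G k \<omega>))\<^sup>2 + 2 * (norm ?c)\<^sup>2"
            by (simp add: power2_norm_eq_inner inner_add_left inner_add_right inner_diff_left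
                inner_diff_right inner_commute)
          moreover have "0 \<le> (norm (G k \<omega> - ?c))\<^sup>2" by simp
          ultimately have "(norm (G k \<omega> + ?c))\<^sup>2 \<le> 2 * (norm (G k \<omega>))\<^sup>2 + 2 * (norm ?c)\<^sup>2"
            by linarith
          then show ?thesis by (simp add: G_def)
        qed
      qed measurable
      then have "(\<integral>\<omega>. X k \<omega> \<bullet> g (Suc k) \<omega> \<partial>M)
          = (\<integral>\<omega>. X k \<omega> \<bullet> vec_cond_exp M (Fil k) (g (Suc k)) \<omega> \<partial>M)"
        by (intro S.integral_inner_vec_cond_exp[symmetric] X_meas X_int) measurable
      also have "\<dots> = (\<integral>\<omega>. X k \<omega> \<bullet> grad F (x k \<omega>) \<partial>M)"
      proof (rule integral_cong_AE)
        show "(\<lambda>\<omega>. X k \<omega> \<bullet> vec_cond_exp M (Fil k) (g (Suc k)) \<omega>) \<in> borel_measurable M"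
          unfolding vec_cond_exp_def by measurable
        have "(\<lambda>\<omega>. X k \<omega> \<bullet> (E k \<omega> + ?c)) \<in> borel_measurable M" by measurable
        then show "(\<lambda>\<omega>. X k \<omega> \<bullet> grad F (x k \<omega>)) \<in> borel_measurable M" by (simp add: E_def)
      qed (use g_mean[of k] in auto)
      also have "(\<lambda>\<omega>. X k \<omega> \<bullet> grad F (x k \<omega>)) = (\<lambda>\<omega>. X k \<omega> \<bullet> E k \<omega> + X k \<omega> \<bullet> ?c)"
        by (simp add: E_def inner_diff_right)
      also have "(\<lambda>\<omega>. X k \<omega> \<bullet> g (Suc k) \<omega>) = (\<lambda>\<omega>. X k \<omega> \<bullet> G k \<omega> + X k \<omega> \<bullet> ?c)"
        by (simp add: G_def inner_diff_right)
      finally show ?thesis using XG_int XE_int c_int by simp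
    qed
    \<comment> \<open>\<open>?B\<close> bounds \<open>V (Suc k)\<close> pathwise and
      \<open>?C\<close> lies below \<open>r * V k\<close> pathwise; between \<open>?B\<close> and
      \<open>?C\<close> the comparison is made only in expectation.\<close>
    let ?B = "\<lambda>\<omega>. (norm (X k \<omega>))\<^sup>2 - 2 * \<gamma> * (X k \<omega> \<bullet> G k \<omega>) + \<gamma>\<^sup>2 * (norm (G k \<omega>))\<^sup>2
      + \<gamma>\<^sup>2 * (norm (Q k \<omega>))\<^sup>2 + d k \<omega> + \<kappa> * \<gamma>\<^sup>2 * (\<sigma> (Suc k) \<omega>)\<^sup>2"
    let ?C = "\<lambda>\<omega>. (norm (X k \<omega>))\<^sup>2 - 2 * \<gamma> * (X k \<omega> \<bullet> E k \<omega>)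
      + \<gamma>\<^sup>2 * (2 * \<alpha> * D k \<omega> + \<beta> * (\<sigma> k \<omega>)\<^sup>2) + \<gamma>\<^sup>2 * (norm (Q k \<omega>))\<^sup>2 + d k \<omega>
      + \<kappa> * \<gamma>\<^sup>2 * ((1 - \<rho>) * (\<sigma> k \<omega>)\<^sup>2 + 2 * \<delta> * D k \<omega>)"
    have V_B: "V (Suc k) \<omega> \<le> ?B \<omega>" if "\<omega> \<in> space M" for \<omega>
    proof -
      have "(norm (X k \<omega> - \<gamma> *\<^sub>R G k \<omega>))\<^sup>2
          = (norm (X k \<omega>))\<^sup>2 - 2 * \<gamma> * (X k \<omega> \<bullet> G k \<omega>) + \<gamma>\<^sup>2 * (norm (G k \<omega>))\<^sup>2"
        unfolding power2_norm_eq_inner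
        by (simp add: inner_diff_left inner_diff_right inner_commute power2_eq_square)
      then show ?thesis using V_Suc[OF that, of k] by simp
    qed
    have B_int: "integrable M ?B"
      using X_int XG_int G_int Q_int d_int \<sigma>'_int by simp
    have V'_int: "integrable M (V (Suc k))"
    proof (rule dom[OF _ B_int])
      fix \<omega> assume \<omega>: "\<omega> \<in> space M"
      have "0 \<le> V (Suc k) \<omega>"
        unfolding V using d_nonneg pos H_smooth(1) \<kappa>0
        by (intro add_nonneg_nonneg mult_nonneg_nonneg) simp_all
      then show "\<bar>V (Suc k) \<omega>\<bar> \<le> ?B \<omega>" using V_B[OF \<omega>] by linarith
    qed measurable
    have "expectation (V (Suc k)) \<le> expectation ?B"
      by (rule integral_mono[OF V'_int B_int V_B])
    also have "\<dots> \<le> expectation ?C"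
    proof -
      have "\<gamma>\<^sup>2 * (\<integral>\<omega>. (norm (G k \<omega>))\<^sup>2 \<partial>M) \<le> \<gamma>\<^sup>2 * (\<integral>\<omega>. 2 * \<alpha> * D k \<omega> + \<beta> * (\<sigma> k \<omega>)\<^sup>2 \<partial>M)"
        by (intro mult_left_mono G_le) simp
      moreover have "\<kappa> * \<gamma>\<^sup>2 * (\<integral>\<omega>. (\<sigma> (Suc k) \<omega>)\<^sup>2 \<partial>M)
          \<le> \<kappa> * \<gamma>\<^sup>2 * (\<integral>\<omega>. (1 - \<rho>) * (\<sigma> k \<omega>)\<^sup>2 + 2 * \<delta> * D k \<omega> \<partial>M)"
        using c0 by (intro mult_left_mono \<sigma>'_le) simp
      ultimately show ?thesis
        using X_int XG_int G_int Q_int d_int \<sigma>'_int XE_int D_int \<sigma>_int by (simp add: XG)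
    qed
    also have "\<dots> \<le> (\<integral>\<omega>. r * V k \<omega> \<partial>M)"
      using X_int Q_int d_int XE_int D_int \<sigma>_int V_int by (intro integral_mono pointwise) simp_all
    also have "\<dots> = r * expectation (V k)" by simp
    finally show ?thesis using V'_int by simp
  qed

  \<comment> \<open>Iteration of the contraction from deterministic initial data\<close>
  define v0 where "v0 = (norm (p0 - ps))\<^sup>2 + (1 + 2 * \<tau> * \<mu>H) * dual_norm_sq L \<gamma> \<tau> (y0 - ys)
    + \<kappa> * \<gamma>\<^sup>2 * \<sigma>0\<^sup>2"
  have V0: "V 0 \<omega> = v0" if "\<omega> \<in> space M" for \<omega>
    unfolding V v0_def using init[OF that] by simp
  have "integrable M (V k) \<and> expectation (V k) \<le> r ^ k * v0" for k
  proof (induction k)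
    case 0
    have "integrable M (V 0) \<longleftrightarrow> integrable M (\<lambda>_. v0)"
      by (rule Bochner_Integration.integrable_cong) (simp_all add: V0)
    moreover have "expectation (V 0) = expectation (\<lambda>_. v0)"
      by (rule Bochner_Integration.integral_cong) (simp_all add: V0)
    ultimately show ?case by (simp add: prob_space)
  next
    case (Suc k)
    have "expectation (V (Suc k)) \<le> r * expectation (V k)" using contraction Suc by blast
    also have "\<dots> \<le> r * (r ^ k * v0)" using Suc r0 by (intro mult_left_mono) auto
    finally show ?case using contraction Suc by (simp add: mult.assoc)
  qed
  then show ?thesis using V0 by auto
qed

end
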